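(* Let $p,q\ge1$, $0\le S<T<\infty$, and let $\mathbb H$ be a Euclidean space. For a given $Z(\cdot,\cdot)\in C^1([S,T];L^{p,q}_{\mathbb F}(S,T;\mathbb H))$, define the progressively measurable process $\mathrm{Diag}[Z](\cdot)$ by $$\mathrm{Diag}[Z](s,\omega):=\begin{cases}Z(S,s,\omega)+\int_S^s\partial_tZ(\tau,s,\omega)\,d\tau&\text{if }\partial_tZ(\cdot,s,\omega)\in L^1(S,T;\mathbb H),\\0&\text{otherwise.}\end{cases}$$ Then the following hold. (i) $\mathrm{Diag}[Z](\cdot)\in L^{p,q}_{\mathbb F}(S,T;\mathbb H)$, and $$\|\mathrm{Diag}[Z](\cdot)\|_{L^{p,q}_{\mathbb F}(S,T;\mathbb H)}\le\|Z(S,\cdot)\|_{L^{p,q}_{\mathbb F}(S,T;\mathbb H)}+(T-S)\sup_{t\in[S,T]}\|\partial_tZ(t,\cdot)\|_{L^{p,q}_{\mathbb F}(S,T;\mathbb H)}.$$ (ii) For any $1\le p'\le p$ and $1\le q'\le q$, $$\mathbb E\Big[\Big(\int_t^{t+\varepsilon}|Z(t,s)-\mathrm{Diag}[Z](s)|^{q'}\,ds\Big)^{p'/q'}\Big]^{1/p'}=o(\varepsilon^{1+1/q'-1/q})\quad(\varepsilon\downarrow0),\qquad\forall\,t\in[S,T).$$ In particular, $\mathrm{Diag}[Z](\cdot)$ is the (unique) process in $L^1_{\mathbb F}(S,T;\mathbb H)$ satisfying Property (D) with respect to $Z(\cdot,\cdot)$.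
   Context: $W(\cdot)$ is a $d$-dimensional Brownian motion on a complete probability space $(\Omega,\mathcal F,\mathbb P)$ and $\mathbb F=(\mathcal F_t)_{t\ge0}$ is the $\mathbb P$-augmentation of the filtration generated by $W$. $L^{p,q}_{\mathbb F}(S,T;\mathbb H)$ is the Banach space of (equivalence classes of) progressively measurable processes $\varphi:\Omega\times[S,T]\to\mathbb H$ with norm $\|\varphi\|=\mathbb E[(\int_S^T|\varphi(s)|^qds)^{p/q}]^{1/p}<\infty$; $L^1_{\mathbb F}:=L^{1,1}_{\mathbb F}$. For a Banach space $\mathcal L$ of processes, $C([S,T];\mathcal L)$ is the space of continuous maps $t\mapsto\varphi(t,\cdot)\in\mathcal L$, always identified with a version jointly measurable on $\Omega\times[S,T]^2$ that agrees with it in $\mathcal L$ for each $t$ (for fixed $t$ progressively measurable in $(s,\omega)$, and jointly measurable with respect to $\mathcal B([S,T])\otimes$ the progressive $\sigma$-field). $C^1([S,T];\mathcal L)$ is the space of continuously differentiable $\mathcal L$-valued maps; the derivative $\partial_tZ(\cdot,\cdot)\in C([S,T];\mathcal L)$ is likewise identified with a jointly measurable version. Property (D): for $Z(\cdot,\cdot)\in C([S,T];L^1_{\mathbb F}(S,T;\mathbb H))$, a process $\mathcal Z(\cdot)\in L^1_{\mathbb F}(S,T;\mathbb H)$ satisfies Property (D) with respect to $Z(\cdot,\cdot)$ if $\lim_{\varepsilon\downarrow0}\frac1\varepsilon\mathbb E\big[\int_t^{t+\varepsilon}|Z(t,s)-\mathcal Z(s)|\,ds\big]=0$ for all $t\in[S,T)$.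 *)

theory Defs
  imports "HOL-Probability.Probability"
begin

definition brownian_motion :: "'w measure \<Rightarrow> (real \<Rightarrow> 'w \<Rightarrow> real ^ 'd) \<Rightarrow> bool" where
  "brownian_motion P W \<longleftrightarrow>
     (\<forall>t\<ge>0. W t \<in> borel_measurable P) \<and>
     (AE \<omega> in P. W 0 \<omega> = 0) \<and>
     (AE \<omega> in P. continuous_on {0..} (\<lambda>t. W t \<omega>)) \<and>
     (\<forall>\<tau> :: nat \<Rightarrow> real. \<forall>n. 0 \<le> \<tau> 0 \<longrightarrow> mono \<tau> \<longrightarrow>
        prob_space.indep_vars P (\<lambda>_. borel) (\<lambda>i \<omega>. W (\<tau> (Suc i)) \<omega> - W (\<tau> i) \<omega>) {..<n}) \<and>
     (\<forall>s t. 0 \<le> s \<longrightarrow> s < t \<longrightarrow>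
        distributed P lborel (\<lambda>\<omega>. W t \<omega> - W s \<omega>)
          (\<lambda>x. ennreal (\<Prod>i\<in>UNIV. normal_density 0 (sqrt (t - s)) (x $ i))))"

definition augmented_filtration ::
    "'w measure \<Rightarrow> (real \<Rightarrow> 'w \<Rightarrow> 'b::topological_space) \<Rightarrow> real \<Rightarrow> 'w measure" where
  "augmented_filtration P W t =
     sigma (space P)
       ({W s -` B \<inter> space P | s B. 0 \<le> s \<and> s \<le> t \<and> B \<in> sets borel} \<union> null_sets P)"

text \<open>The progressive \<open>\<sigma>\<close>-field on \<open>[S,T] \<times> \<Omega>\<close>. The generating family is already a
  \<open>\<sigma>\<close>-field, see \<open>sets_progressive\<close>; measurability with respect to it is the usual
  progressive measurability, see \<open>measurable_progressive_iff\<close>. Processes take the time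
  argument first.\<close>

definition progressive :: "(real \<Rightarrow> 'w measure) \<Rightarrow> real \<Rightarrow> real \<Rightarrow> (real \<times> 'w) measure" where
  "progressive F S T =
     sigma ({S..T} \<times> space (F T))
       {A. A \<subseteq> {S..T} \<times> space (F T) \<and>
           (\<forall>t\<in>{S..T}. A \<inter> ({S..t} \<times> space (F t)) \<in> sets (restrict_space borel {S..t} \<Otimes>\<^sub>M F t))}"

lemma space_augmented_filtration [simp]: "space (augmented_filtration P W t) = space P"
  unfolding augmented_filtration_def
  by (rule space_measure_of) (use sets.sets_into_space in fastforce)

lemma space_progressive: "space (progressive F S T) = {S..T} \<times> space (F T)"
  unfolding progressive_def by (rule space_measure_of) auto

lemma sets_progressive:
  assumes space: "\<And>t. space (F t) = \<Omega>"
  shows "sets (progressive F S T) =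
     {A. A \<subseteq> {S..T} \<times> \<Omega> \<and>
         (\<forall>t\<in>{S..T}. A \<inter> ({S..t} \<times> \<Omega>) \<in> sets (restrict_space borel {S..t} \<Otimes>\<^sub>M F t))}"
    (is "_ = ?\<A>")
proof -
  have sp: "{S..t} \<times> \<Omega> = space (restrict_space borel {S..t} \<Otimes>\<^sub>M F t)" for t
    by (simp add: space_pair_measure space_restrict_space space)
  have "sigma_algebra ({S..T} \<times> \<Omega>) ?\<A>"
    unfolding sigma_algebra_iff2
  proof (intro conjI ballI allI impI)
    fix A assume A: "A \<in> ?\<A>"
    have "({S..T} \<times> \<Omega> - A) \<inter> ({S..t} \<times> \<Omega>) \<in> sets (restrict_space borel {S..t} \<Otimes>\<^sub>M F t)"
      if "t \<in> {S..T}" for t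
    proof -
      have "({S..T} \<times> \<Omega> - A) \<inter> ({S..t} \<times> \<Omega>)
          = space (restrict_space borel {S..t} \<Otimes>\<^sub>M F t) - A \<inter> ({S..t} \<times> \<Omega>)"
        using that by (auto simp flip: sp)
      then show ?thesis
        using A that by auto
    qed
    then show "{S..T} \<times> \<Omega> - A \<in> ?\<A>"
      by auto
  next
    fix A :: "nat \<Rightarrow> _" assume A: "range A \<subseteq> ?\<A>"
    have "(\<Union>i. A i \<inter> ({S..t} \<times> \<Omega>)) \<in> sets (restrict_space borel {S..t} \<Otimes>\<^sub>M F t)"
      if "t \<in> {S..T}" for t
      using A that by (intro sets.countable_UN) auto
    moreover have eq: "(\<Union>i. A i) \<inter> X = (\<Union>i. A i \<inter> X)" for X
      by blast
    ultimately have "(\<Union>i. A i) \<inter> ({S..t} \<times> \<Omega>) \<in> sets (restrict_space borel {S..t} \<Otimes>\<^sub>M F t)"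
      if "t \<in> {S..T}" for t
      using that unfolding eq by blast
    moreover have "(\<Union>i. A i) \<subseteq> {S..T} \<times> \<Omega>"
      using A by blast
    ultimately show "(\<Union>i. A i) \<in> ?\<A>"
      by blast
  qed auto
  then show ?thesis
    unfolding progressive_def space by (simp add: sigma_algebra.sets_measure_of_eq)
qed

lemma measurable_progressive_iff:
  fixes f :: "real \<times> 'w \<Rightarrow> 'b::topological_space"
  assumes space: "\<And>t. space (F t) = \<Omega>"
  shows "f \<in> borel_measurable (progressive F S T) \<longleftrightarrow>
    (\<forall>t\<in>{S..T}. f \<in> borel_measurable (restrict_space borel {S..t} \<Otimes>\<^sub>M F t))"
proof -
  have eq: "(f -` B \<inter> {S..T} \<times> \<Omega>) \<inter> ({S..t} \<times> \<Omega>) = f -` B \<inter> {S..t} \<times> \<Omega>" if "t \<in> {S..T}" for t B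
    using that by auto
  have "f \<in> borel_measurable (progressive F S T) \<longleftrightarrow>
      (\<forall>B\<in>sets borel. \<forall>t\<in>{S..T}.
        f -` B \<inter> {S..t} \<times> \<Omega> \<in> sets (restrict_space borel {S..t} \<Otimes>\<^sub>M F t))"
    unfolding measurable_def space_progressive sets_progressive[of F, OF space] space
    by (auto simp: eq)
  also have "\<dots> \<longleftrightarrow> (\<forall>t\<in>{S..T}. f \<in> borel_measurable (restrict_space borel {S..t} \<Otimes>\<^sub>M F t))"
    unfolding measurable_def by (auto simp: space_pair_measure space_restrict_space space)
  finally show ?thesis .
qed

text \<open>Real powers on the extended half-line, for exponents \<open>a > 0\<close>.\<close>

definition ennpowr :: "ennreal \<Rightarrow> real \<Rightarrow> ennreal" where
  "ennpowr x a = (if x = \<top> then \<top> else ennreal (enn2real x powr a))"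

definition Lpq_norm ::
    "'w measure \<Rightarrow> real \<Rightarrow> real \<Rightarrow> real \<Rightarrow> real \<Rightarrow> (real \<Rightarrow> 'w \<Rightarrow> 'h::euclidean_space) \<Rightarrow> ennreal" where
  "Lpq_norm P p q a b \<phi> =
     ennpowr (\<integral>\<^sup>+ \<omega>. ennpowr (\<integral>\<^sup>+ s\<in>{a..b}. ennreal (norm (\<phi> s \<omega>) powr q) \<partial>lborel) (p / q) \<partial>P) (1 / p)"

definition Lpq ::
    "'w measure \<Rightarrow> (real \<Rightarrow> 'w measure) \<Rightarrow> real \<Rightarrow> real \<Rightarrow> real \<Rightarrow> real
      \<Rightarrow> (real \<Rightarrow> 'w \<Rightarrow> 'h::euclidean_space) set" where
  "Lpq P F p q S T =
     {\<phi>. (\<lambda>(s, \<omega>). \<phi> s \<omega>) \<in> borel_measurable (progressive F S T) \<and> Lpq_norm P p q S T \<phi> < \<infinity>}"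

text \<open>Elements of \<open>L\<^sup>p\<^sup>,\<^sup>q\<close> are represented by processes; this is equality of the classes.\<close>

definition process_eq ::
    "'w measure \<Rightarrow> real \<Rightarrow> real \<Rightarrow> (real \<Rightarrow> 'w \<Rightarrow> 'h) \<Rightarrow> (real \<Rightarrow> 'w \<Rightarrow> 'h) \<Rightarrow> bool" where
  "process_eq P S T \<phi> \<psi> \<longleftrightarrow>
     (AE (s, \<omega>) in restrict_space lborel {S..T} \<Otimes>\<^sub>M P. \<phi> s \<omega> = \<psi> s \<omega>)"

text \<open>\<open>C([S,T]; L\<^sup>p\<^sup>,\<^sup>q)\<close>, its elements being identified with their jointly measurable versions.\<close>

definition C_Lpq ::
    "'w measure \<Rightarrow> (real \<Rightarrow> 'w measure) \<Rightarrow> real \<Rightarrow> real \<Rightarrow> real \<Rightarrow> real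
      \<Rightarrow> (real \<Rightarrow> real \<Rightarrow> 'w \<Rightarrow> 'h::euclidean_space) set" where
  "C_Lpq P F p q S T =
     {Z. (\<lambda>(t, s, \<omega>). Z t s \<omega>) \<in> borel_measurable (restrict_space borel {S..T} \<Otimes>\<^sub>M progressive F S T) \<and>
         (\<forall>t\<in>{S..T}. Z t \<in> Lpq P F p q S T) \<and>
         (\<forall>t\<in>{S..T}. ((\<lambda>r. Lpq_norm P p q S T (\<lambda>s \<omega>. Z r s \<omega> - Z t s \<omega>)) \<longlongrightarrow> 0) (at t within {S..T}))}"

text \<open>The derivative is determined only up to the choice of a jointly measurable version, so it
  enters as an explicit argument: \<open>Z \<in> C\<^sup>1([S,T]; L\<^sup>p\<^sup>,\<^sup>q)\<close> and \<open>DZ\<close> is a version of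
  \<open>\<partial>\<^sub>tZ\<close>.\<close>

definition C1_Lpq ::
    "'w measure \<Rightarrow> (real \<Rightarrow> 'w measure) \<Rightarrow> real \<Rightarrow> real \<Rightarrow> real \<Rightarrow> real
      \<Rightarrow> (real \<Rightarrow> real \<Rightarrow> 'w \<Rightarrow> 'h::euclidean_space) \<Rightarrow> (real \<Rightarrow> real \<Rightarrow> 'w \<Rightarrow> 'h) \<Rightarrow> bool" where
  "C1_Lpq P F p q S T Z DZ \<longleftrightarrow>
     Z \<in> C_Lpq P F p q S T \<and> DZ \<in> C_Lpq P F p q S T \<and>
     (\<forall>t\<in>{S..T}.
        ((\<lambda>r. Lpq_norm P p q S T (\<lambda>s \<omega>. (Z r s \<omega> - Z t s \<omega>) /\<^sub>R (r - t) - DZ t s \<omega>)) \<longlongrightarrow> 0)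
          (at t within {S..T}))"

definition Diag ::
    "real \<Rightarrow> real \<Rightarrow> (real \<Rightarrow> real \<Rightarrow> 'w \<Rightarrow> 'h::euclidean_space) \<Rightarrow> (real \<Rightarrow> real \<Rightarrow> 'w \<Rightarrow> 'h)
      \<Rightarrow> real \<Rightarrow> 'w \<Rightarrow> 'h" where
  "Diag S T Z DZ s \<omega> =
     (if set_integrable lborel {S..T} (\<lambda>\<tau>. DZ \<tau> s \<omega>)
      then Z S s \<omega> + (LINT \<tau>:{S..s}|lborel. DZ \<tau> s \<omega>) else 0)"

definition property_D ::
    "'w measure \<Rightarrow> (real \<Rightarrow> 'w measure) \<Rightarrow> real \<Rightarrow> real
      \<Rightarrow> (real \<Rightarrow> real \<Rightarrow> 'w \<Rightarrow> 'h::euclidean_space) \<Rightarrow> (real \<Rightarrow> 'w \<Rightarrow> 'h) \<Rightarrow> bool" where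
  "property_D P F S T Z \<phi> \<longleftrightarrow>
     Z \<in> C_Lpq P F 1 1 S T \<and> \<phi> \<in> Lpq P F 1 1 S T \<and>
     (\<forall>t\<in>{S..<T}.
        ((\<lambda>\<epsilon>. ennreal (1 / \<epsilon>) *
              (\<integral>\<^sup>+ \<omega>. (\<integral>\<^sup>+ s\<in>{t..t + \<epsilon>}. ennreal (norm (Z t s \<omega> - \<phi> s \<omega>)) \<partial>lborel) \<partial>P)) \<longlongrightarrow> 0)
          (at_right 0))"

end

theory Submission
  imports Defs
begin

text \<open>Write \<open>N\<close> for the norm of \<open>L\<^sup>p\<^sup>,\<^sup>q\<close>. The proof rests on one identity and one inequality.

The identity is the fundamental theorem of calculus: for every \<open>t\<close>,
\<open>Z(t,s) = Z(S,s) + \<integral>\<^sub>S\<^sup>t \<partial>\<^sub>tZ(\<tau>,s) d\<tau>\<close> for almost every \<open>(s,\<omega>)\<close> (\<open>AE_Z_eq_integral\<close>).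
Call the difference of the two sides the remainder at \<open>t\<close>. Between \<open>t\<close> and \<open>r\<close> it changes by
\<open>o(\<bar>r - t\<bar>)\<close> in \<open>N\<close>, so its \<open>N\<close>-norm is a real function of \<open>t\<close> with derivative 0 that vanishes at \<open>S\<close>.
Working with this one real function avoids integrals of Banach-space valued maps: only the pathwise
integral over \<open>\<tau>\<close> occurs. Subtracting the identity from the definition of the diagonal gives
\<open>Diag[Z](s) - Z(t,s) = \<integral>\<^sub>t\<^sup>s \<partial>\<^sub>tZ(\<tau>,s) d\<tau>\<close> almost everywhere on \<open>s > t\<close>.

The inequality is Minkowski's integral inequality for the mixed norm
(\<open>mixed_Lp_minkowski_integral\<close>), which bounds the norm of a pathwise integral over \<open>\<tau>\<close> by the
integral of the norms. Over \<open>[S,T]\<close> it gives the bound (i). Over \<open>[t,t+\<epsilon>]\<close>, splitting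
\<open>\<partial>\<^sub>tZ(\<tau>) = (\<partial>\<^sub>tZ(\<tau>) - \<partial>\<^sub>tZ(t)) + \<partial>\<^sub>tZ(t)\<close>, it bounds the norm of \<open>Diag[Z] - Z(t)\<close> on \<open>[t,t+\<epsilon>]\<close> by
\<open>\<epsilon>\<close> times a factor that tends to 0: the first summand is small by continuity of \<open>\<partial>\<^sub>tZ\<close>, the second one
because the norm of the fixed process \<open>\<partial>\<^sub>tZ(t)\<close> over the shrinking interval \<open>[t,t+\<epsilon>]\<close> tends to 0 by
dominated convergence (\<open>nrm_Z_minus_Diag_small\<close>). Lowering the exponents by Jensen's inequality contributes the
factor \<open>\<epsilon>\<close> to the power \<open>1/q' - 1/q\<close>, which gives (ii), and \<open>p' = q' = 1\<close> gives Property (D).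

For uniqueness, let \<open>\<phi>\<close> also satisfy Property (D). By the triangle inequality, the measure
\<open>A \<mapsto> E \<integral>\<^sub>A \<bar>\<phi> - Diag[Z]\<bar> ds\<close> has right derivative 0 at every point of \<open>[S,T)\<close>. Since this holds at
every point and the measure has no atoms, an elementary supremum argument shows
that the measure vanishes (\<open>nn_integral_eq_0_if_right_derivative_0\<close>).

Norms are studied for functions with values in \<open>[0,\<infinity>]\<close>, so that the integrals in them always make sense;
processes enter through their pointwise norms.\<close>

section \<open>Real powers on the extended half-line\<close>

lemma ennpowr_top [simp]: "ennpowr \<top> a = \<top>"
  by (simp add: ennpowr_def)

lemma ennpowr_ennreal: "0 \<le> x \<Longrightarrow> ennpowr (ennreal x) a = ennreal (x powr a)"
  by (simp add: ennpowr_def)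

lemma ennpowr_0 [simp]: "ennpowr 0 a = 0"
  by (simp add: ennpowr_def)

lemma ennpowr_1 [simp]: "ennpowr x 1 = x"
  by (cases x) (auto simp: ennpowr_ennreal)

lemma ennpowr_eq_0_iff [simp]: "ennpowr x a = 0 \<longleftrightarrow> x = 0"
  by (cases x) (auto simp: ennpowr_ennreal)

lemma ennpowr_eq_top_iff [simp]: "ennpowr x a = \<top> \<longleftrightarrow> x = \<top>"
  by (auto simp: ennpowr_def)

lemma ennpowr_less_top_iff [simp]: "ennpowr x a < \<top> \<longleftrightarrow> x < \<top>"
  by (simp add: less_top[symmetric])

lemma ennpowr_mono: "x \<le> y \<Longrightarrow> 0 \<le> a \<Longrightarrow> ennpowr x a \<le> ennpowr y a"
  by (cases x; cases y) (auto simp: ennpowr_ennreal intro!: ennreal_leI powr_mono2 simp: top_unique)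

lemma ennpowr_mult: "0 < a \<Longrightarrow> ennpowr (x * y) a = ennpowr x a * ennpowr y a"
  by (cases x; cases y)
    (auto simp: ennpowr_ennreal powr_mult ennreal_top_mult ennreal_mult_top ennreal_mult[symmetric])

lemma ennpowr_inverse: "0 < a \<Longrightarrow> ennpowr (inverse x) a = inverse (ennpowr x a)"
proof (cases x)
  case (real r)
  assume "0 < a"
  with real show ?thesis
    by (cases "r = 0") (auto simp: ennpowr_ennreal inverse_ennreal inverse_powr)
qed simp

lemma ennpowr_ennpowr: "ennpowr (ennpowr x a) b = ennpowr x (a * b)"
  by (cases x) (auto simp: ennpowr_ennreal powr_powr)

lemma ennpowr_cancel [simp]:
  "a \<noteq> 0 \<Longrightarrow> ennpowr (ennpowr x a) (1 / a) = x"
  "a \<noteq> 0 \<Longrightarrow> ennpowr (ennpowr x (1 / a)) a = x"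
  by (simp_all add: ennpowr_ennpowr)

lemma measurable_ennpowr [measurable]:
  "f \<in> borel_measurable M \<Longrightarrow> (\<lambda>x. ennpowr (f x) a) \<in> borel_measurable M"
proof -
  have "(\<lambda>y::ennreal. enn2real y powr a) \<in> borel_measurable borel"
    by measurable
  then have "(\<lambda>y. ennpowr y a) \<in> borel_measurable borel"
    unfolding ennpowr_def by (intro measurable_If) auto
  then show "f \<in> borel_measurable M \<Longrightarrow> ?thesis"
    by (rule measurable_compose[rotated])
qed

text \<open>Continuity of the power at 0, obtained by monotonicity from the inverse power \<open>1 / a\<close>.\<close>

lemma tendsto_ennpowr_0:
  assumes "(f \<longlongrightarrow> 0) F" "0 < a"
  shows "((\<lambda>x. ennpowr (f x) a) \<longlongrightarrow> 0) F"
proof (rule order_tendstoI)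
  fix y :: ennreal assume "0 < y"
  then have "0 < ennpowr y (1 / a)"
    by (metis ennpowr_eq_0_iff zero_less_iff_neq_zero)
  then have "eventually (\<lambda>x. f x < ennpowr y (1 / a)) F"
    using assms(1) order_tendstoD(2) by blast
  then show "eventually (\<lambda>x. ennpowr (f x) a < y) F"
  proof eventually_elim
    case (elim x)
    then have "ennpowr (f x) a \<le> y"
      using ennpowr_mono[of "f x" "ennpowr y (1 / a)" a] assms(2) by simp
    moreover have "ennpowr (f x) a \<noteq> y"
      using elim assms(2) by auto
    ultimately show ?case by simp
  qed
qed simp

lemma tendsto_0_ennrealI:
  fixes f :: "'a \<Rightarrow> ennreal"
  assumes "\<And>e. 0 < e \<Longrightarrow> \<forall>\<^sub>F x in F. f x \<le> ennreal e"
  shows "(f \<longlongrightarrow> 0) F"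
proof (rule order_tendstoI)
  fix y :: ennreal assume "0 < y"
  then obtain z where z: "0 < z" "z < y" using dense by blast
  then have "z < \<top>" using order_less_le_trans top_greatest by blast
  with z have z': "z = ennreal (enn2real z)" "0 < enn2real z"
    by (simp_all add: enn2real_positive_iff)
  show "\<forall>\<^sub>F x in F. f x < y"
    using assms[OF z'(2)] by eventually_elim (use z z' in auto)
qed simp

section \<open>Jensen's and Minkowski's inequalities for nonnegative integrals\<close>

text \<open>Convexity of the power, in the form that the tangent at \<open>c\<close> lies below the graph. It is
Young's inequality for the weights \<open>1 / r\<close> and \<open>1 - 1 / r\<close>.\<close>

lemma powr_ge_tangent:
  fixes x c r :: real
  assumes "0 \<le> x" "0 < c" "1 \<le> r"
  shows "r * c powr (r - 1) * x \<le> x powr r + (r - 1) * c powr r"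
proof (cases "x = 0 \<or> r = 1")
  case True
  then show ?thesis using assms by auto
next
  case False
  then have x: "x > 0" and r: "r > 1" using assms by auto
  have "(x powr r) powr (1 / r) * (c powr r) powr (1 - 1 / r) \<le> (1 / r) * x powr r + (1 - 1 / r) * c powr r"
    by (rule Youngs_inequality_0) (use x r assms in auto)
  also have "(x powr r) powr (1 / r) * (c powr r) powr (1 - 1 / r) = c powr (r - 1) * x"
    using x r assms by (simp add: powr_powr algebra_simps)
  finally have "r * (c powr (r - 1) * x) \<le> r * ((1 / r) * x powr r + (1 - 1 / r) * c powr r)"
    using r by (intro mult_left_mono) auto
  also have "\<dots> = x powr r + (r - 1) * c powr r"
    using r by (simp add: field_simps)
  finally show ?thesis by (simp add: mult.assoc)
qed

text \<open>Integrating the tangent inequality at the mean \<open>c\<close> gives the result, as the linear terms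
combine to \<open>c powr r\<close>. An infinite mean forces an infinite right-hand side because
\<open>y \<le> 1 + y powr r\<close>.\<close>

lemma (in prob_space) nn_jensen:
  assumes [measurable]: "f \<in> borel_measurable M" and r: "1 \<le> r"
  shows "ennpowr (\<integral>\<^sup>+x. f x \<partial>M) r \<le> (\<integral>\<^sup>+x. ennpowr (f x) r \<partial>M)"
proof (cases "\<integral>\<^sup>+x. f x \<partial>M")
  case (real c)
  show ?thesis
  proof (cases "c = 0")
    case False
    with real have c: "c > 0" by simp
    have "ennreal (r * c powr (r - 1)) * y \<le> ennpowr y r + ennreal ((r - 1) * c powr r)" for y
      using powr_ge_tangent[OF _ c r, of "enn2real y"] r
      by (cases y) (auto simp: ennpowr_ennreal ennreal_mult[symmetric] ennreal_plus[symmetric]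
          simp del: ennreal_plus intro!: ennreal_leI)
    then have "(\<integral>\<^sup>+x. ennreal (r * c powr (r - 1)) * f x \<partial>M)
        \<le> (\<integral>\<^sup>+x. ennpowr (f x) r + ennreal ((r - 1) * c powr r) \<partial>M)"
      by (intro nn_integral_mono)
    then have "ennreal (r * c powr (r - 1)) * ennreal c
        \<le> (\<integral>\<^sup>+x. ennpowr (f x) r \<partial>M) + ennreal ((r - 1) * c powr r)"
      using real by (simp add: nn_integral_cmult nn_integral_add emeasure_space_1)
    moreover have "ennreal (r * c powr (r - 1)) * ennreal c = ennreal (c powr r) + ennreal ((r - 1) * c powr r)"
      using c r powr_add[of c "r - 1" 1]
      by (simp add: ennreal_mult[symmetric] ennreal_plus[symmetric] algebra_simps del: ennreal_plus)
    ultimately show ?thesis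
      using real by (simp add: ennpowr_ennreal ennreal_add_left_cancel_le add.commute)
  qed (use real in simp)
next
  case top
  have "y \<le> 1 + ennpowr y r" for y
  proof (cases y)
    case (real z)
    have "z \<le> 1 + z powr r"
      using powr_mono[of 1 r z] r real by (cases "z \<le> 1") (auto simp: add_increasing2)
    with real show ?thesis
      by (simp add: ennpowr_ennreal ennreal_plus[symmetric] ennreal_1[symmetric] del: ennreal_plus ennreal_1)
  qed simp
  then have "(\<integral>\<^sup>+x. f x \<partial>M) \<le> (\<integral>\<^sup>+x. 1 + ennpowr (f x) r \<partial>M)"
    by (intro nn_integral_mono)
  also have "\<dots> = 1 + (\<integral>\<^sup>+x. ennpowr (f x) r \<partial>M)"
    by (simp add: nn_integral_add emeasure_space_1)
  finally have "(\<integral>\<^sup>+x. ennpowr (f x) r \<partial>M) = \<top>"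
    using top by (simp add: top_unique ennreal_add_eq_top)
  then show ?thesis by simp
qed

definition enn_Lp :: "'a measure \<Rightarrow> real \<Rightarrow> ('a \<Rightarrow> ennreal) \<Rightarrow> ennreal" where
  "enn_Lp M p f = ennpowr (\<integral>\<^sup>+x. ennpowr (f x) p \<partial>M) (1 / p)"

lemma ennpowr_enn_Lp: "p \<noteq> 0 \<Longrightarrow> ennpowr (enn_Lp M p f) p = (\<integral>\<^sup>+x. ennpowr (f x) p \<partial>M)"
  by (simp add: enn_Lp_def)

lemma enn_Lp_1: "enn_Lp M 1 f = (\<integral>\<^sup>+x. f x \<partial>M)"
  by (simp add: enn_Lp_def)

lemma enn_Lp_leI:
  assumes "0 < p" "(\<integral>\<^sup>+x. ennpowr (f x) p \<partial>M) \<le> ennpowr c p"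
  shows "enn_Lp M p f \<le> c"
  using ennpowr_mono[OF assms(2), of "1 / p"] assms(1) by (simp add: enn_Lp_def)

lemma enn_Lp_mono_AE:
  assumes "0 < p" "AE x in M. f x \<le> g x"
  shows "enn_Lp M p f \<le> enn_Lp M p g"
  unfolding enn_Lp_def
  by (intro ennpowr_mono nn_integral_mono_AE) (use assms in \<open>auto intro: ennpowr_mono elim!: eventually_mono\<close>)

lemma enn_Lp_cong_AE: "AE x in M. f x = g x \<Longrightarrow> enn_Lp M p f = enn_Lp M p g"
  unfolding enn_Lp_def by (intro arg_cong2[of _ _ _ _ ennpowr] nn_integral_cong_AE) auto

lemma enn_Lp_eq_0_iff:
  assumes [measurable]: "f \<in> borel_measurable M"
  shows "enn_Lp M p f = 0 \<longleftrightarrow> (AE x in M. f x = 0)"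
  by (simp add: enn_Lp_def nn_integral_0_iff_AE)

lemma AE_finite_if_enn_Lp_finite:
  assumes [measurable]: "f \<in> borel_measurable M" and "enn_Lp M p f < \<top>"
  shows "AE x in M. f x < \<top>"
proof -
  have "AE x in M. ennpowr (f x) p \<noteq> \<infinity>"
    by (rule nn_integral_PInf_AE) (use assms(2) in \<open>auto simp: enn_Lp_def\<close>)
  then show ?thesis by (simp add: less_top)
qed

lemma enn_Lp_cmult:
  assumes [measurable]: "f \<in> borel_measurable M" and "0 < p"
  shows "enn_Lp M p (\<lambda>x. c * f x) = c * enn_Lp M p f"
  using assms(2) by (simp add: enn_Lp_def ennpowr_mult nn_integral_cmult)

lemma (in sigma_finite_measure) measurable_enn_Lp [measurable (raw)]:
  assumes [measurable]: "case_prod f \<in> borel_measurable (N \<Otimes>\<^sub>M M)"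
  shows "(\<lambda>y. enn_Lp M p (f y)) \<in> borel_measurable N"
  unfolding enn_Lp_def by measurable

text \<open>Put \<open>a x\<close> for the norm of \<open>f x\<close> and \<open>A\<close> for the right-hand side. Under the probability measure with
density \<open>a / A\<close>, the inner integral is \<open>A\<close> times the mean of \<open>f x y / a x\<close>. Jensen's inequality moves the power
\<open>p\<close> inside this mean, and after exchanging the integrals each normalised function \<open>f x / a x\<close> has norm at
most 1.\<close>

theorem enn_Lp_minkowski_integral:
  assumes "sigma_finite_measure M" "sigma_finite_measure N"
  assumes f [measurable]: "case_prod f \<in> borel_measurable (M \<Otimes>\<^sub>M N)" and p: "1 \<le> p"
  shows "enn_Lp N p (\<lambda>y. \<integral>\<^sup>+x. f x y \<partial>M) \<le> (\<integral>\<^sup>+x. enn_Lp N p (f x) \<partial>M)"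
proof -
  interpret M: sigma_finite_measure M by fact
  interpret N: sigma_finite_measure N by fact
  interpret pair_sigma_finite M N ..
  have swap [measurable]: "(\<lambda>(y, x). f x y) \<in> borel_measurable (N \<Otimes>\<^sub>M M)"
    using measurable_pair_swap[OF f] by (simp add: case_prod_unfold)
  have fx [measurable]: "f x \<in> borel_measurable N" if "x \<in> space M" for x
    using that by measurable
  define a where "a = (\<lambda>x. enn_Lp N p (f x))"
  have a [measurable]: "a \<in> borel_measurable M"
    unfolding a_def by measurable
  define A where "A = (\<integral>\<^sup>+x. a x \<partial>M)"
  \<comment> \<open>Where \<open>a\<close> vanishes, dividing by it does no harm: \<open>f\<close> vanishes there as well, for almost every \<open>y\<close>.\<close>
  have zero: "AE y in N. AE x in M. a x = 0 \<longrightarrow> f x y = 0"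
  proof -
    have "AE x in M. AE y in N. a x = 0 \<longrightarrow> f x y = 0"
    proof (rule AE_I2)
      fix x assume "x \<in> space M"
      then show "AE y in N. a x = 0 \<longrightarrow> f x y = 0"
        using enn_Lp_eq_0_iff[OF fx, of x p] by (cases "a x = 0") (auto simp: a_def)
    qed
    then show ?thesis
      by (subst (asm) AE_commute) measurable
  qed
  consider "A = \<top>" | "A = 0" | "0 < A" "A < \<top>"
    by (metis less_top not_gr_zero)
  then have "enn_Lp N p (\<lambda>y. \<integral>\<^sup>+x. f x y \<partial>M) \<le> A"
  proof cases
    case 2
    then have "AE x in M. a x = 0"
      by (simp add: A_def nn_integral_0_iff_AE)
    from zero have "AE y in N. AE x in M. f x y = 0"
    proof eventually_elim
      case (elim y)
      with \<open>AE x in M. a x = 0\<close> show ?case by eventually_elim simp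
    qed
    then have "AE y in N. (\<integral>\<^sup>+x. f x y \<partial>M) = 0"
    proof eventually_elim
      case (elim y)
      then have "(\<integral>\<^sup>+x. f x y \<partial>M) = (\<integral>\<^sup>+x. 0 \<partial>M)" by (intro nn_integral_cong_AE) auto
      then show ?case by simp
    qed
    then have "enn_Lp N p (\<lambda>y. \<integral>\<^sup>+x. f x y \<partial>M) = 0"
      by (subst enn_Lp_eq_0_iff) auto
    then show ?thesis by simp
  next
    case 3
    define \<mu> where "\<mu> = density M (\<lambda>x. a x / A)"
    have [measurable_cong]: "sets \<mu> = sets M" by (simp add: \<mu>_def)
    have [simp]: "space \<mu> = space M" by (simp add: \<mu>_def)
    have "emeasure \<mu> (space \<mu>) = (\<integral>\<^sup>+x. a x / A \<partial>M)"
      unfolding \<mu>_def by (simp add: emeasure_density nn_integral_set_ennreal[symmetric] cong: nn_integral_cong_simp)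
    also have "\<dots> = 1"
      using 3 by (simp add: nn_integral_divide flip: A_def)
    finally interpret \<mu>: prob_space \<mu> by (rule prob_spaceI)
    interpret \<mu>N: pair_sigma_finite \<mu> N ..
    have fin: "AE x in M. a x \<noteq> \<infinity>"
      by (rule nn_integral_PInf_AE) (use 3 in \<open>auto simp: A_def\<close>)
    have le: "AE y in N. ennpowr (\<integral>\<^sup>+x. f x y \<partial>M) p \<le> ennpowr A p * (\<integral>\<^sup>+x. ennpowr (f x y / a x) p \<partial>\<mu>)"
      using zero AE_space
    proof eventually_elim
      case (elim y)
      have [measurable]: "(\<lambda>x. f x y) \<in> borel_measurable M"
        using elim(2) by measurable
      have "(\<integral>\<^sup>+x. f x y \<partial>M) = (\<integral>\<^sup>+x. A * ((a x / A) * (f x y / a x)) \<partial>M)"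
      proof (rule nn_integral_cong_AE)
        show "AE x in M. f x y = A * ((a x / A) * (f x y / a x))"
          using elim(1) fin
        proof eventually_elim
          case (elim x)
          show ?case
          proof (cases "a x = 0")
            case False
            have "A * ((a x / A) * (f x y / a x)) = (A * inverse A) * (a x * inverse (a x)) * f x y"
              by (simp add: divide_ennreal_def mult_ac)
            also have "A * inverse A = 1"
              using 3 ennreal_divide_self[of A] by (simp add: divide_ennreal_def)
            also have "a x * inverse (a x) = 1"
              using False elim(2) ennreal_divide_self[of "a x"] by (simp add: divide_ennreal_def less_top)
            finally show ?thesis by simp
          qed (use elim in simp)
        qed
      qed
      also have "\<dots> = A * (\<integral>\<^sup>+x. f x y / a x \<partial>\<mu>)"
        by (simp add: nn_integral_cmult \<mu>_def nn_integral_density)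
      finally have "ennpowr (\<integral>\<^sup>+x. f x y \<partial>M) p = ennpowr A p * ennpowr (\<integral>\<^sup>+x. f x y / a x \<partial>\<mu>) p"
        using p by (simp add: ennpowr_mult)
      also have "\<dots> \<le> ennpowr A p * (\<integral>\<^sup>+x. ennpowr (f x y / a x) p \<partial>\<mu>)"
        by (intro mult_left_mono \<mu>.nn_jensen p) auto
      finally show ?case .
    qed
    have "(\<integral>\<^sup>+y. ennpowr (\<integral>\<^sup>+x. f x y \<partial>M) p \<partial>N)
        \<le> (\<integral>\<^sup>+y. ennpowr A p * (\<integral>\<^sup>+x. ennpowr (f x y / a x) p \<partial>\<mu>) \<partial>N)"
      using le by (rule nn_integral_mono_AE)
    also have "\<dots> = ennpowr A p * (\<integral>\<^sup>+y. (\<integral>\<^sup>+x. ennpowr (f x y / a x) p \<partial>\<mu>) \<partial>N)"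
      by (intro nn_integral_cmult) measurable
    also have "(\<integral>\<^sup>+y. (\<integral>\<^sup>+x. ennpowr (f x y / a x) p \<partial>\<mu>) \<partial>N)
        = (\<integral>\<^sup>+x. (\<integral>\<^sup>+y. ennpowr (f x y / a x) p \<partial>N) \<partial>\<mu>)"
      by (intro \<mu>N.Fubini') measurable
    also have "\<dots> \<le> (\<integral>\<^sup>+x. 1 \<partial>\<mu>)"
    proof (rule nn_integral_mono)
      fix x assume "x \<in> space \<mu>"
      then have [measurable]: "f x \<in> borel_measurable N" by simp
      have "(\<integral>\<^sup>+y. ennpowr (f x y / a x) p \<partial>N) = (\<integral>\<^sup>+y. ennpowr (f x y) p \<partial>N) * inverse (ennpowr (a x) p)"
        using p by (simp add: divide_ennreal_def ennpowr_mult ennpowr_inverse nn_integral_multc)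
      also have "(\<integral>\<^sup>+y. ennpowr (f x y) p \<partial>N) = ennpowr (a x) p"
        using p by (simp add: a_def ennpowr_enn_Lp)
      also have "ennpowr (a x) p * inverse (ennpowr (a x) p) \<le> 1"
      proof -
        have "c * inverse c \<le> 1" for c :: ennreal
          by (cases "c = 0 \<or> c = \<top>") (auto simp: divide_ennreal_def[symmetric] ennreal_divide_self less_top)
        then show ?thesis .
      qed
      finally show "(\<integral>\<^sup>+y. ennpowr (f x y / a x) p \<partial>N) \<le> 1" .
    qed
    also have "(\<integral>\<^sup>+x. 1 \<partial>\<mu>) = 1" by (simp add: \<mu>.emeasure_space_1[simplified])
    finally show ?thesis
      using p by (intro enn_Lp_leI) (auto simp: mult_left_mono)
  qed simp
  then show ?thesis by (simp add: A_def a_def)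
qed

text \<open>The integral inequality for the counting measure on two points.\<close>

lemma enn_Lp_triangle:
  assumes N: "sigma_finite_measure N" and p: "1 \<le> p"
    and [measurable]: "f \<in> borel_measurable N" "g \<in> borel_measurable N"
  shows "enn_Lp N p (\<lambda>y. f y + g y) \<le> enn_Lp N p f + enn_Lp N p g"
proof -
  let ?B = "count_space (UNIV :: bool set)"
  have sum: "(\<integral>\<^sup>+b. h b \<partial>?B) = h True + h False" for h :: "bool \<Rightarrow> ennreal"
    by (subst nn_integral_count_space_finite) (auto simp: UNIV_bool add.commute)
  have "sigma_finite_measure ?B"
    by (intro sigma_finite_measure_count_space_finite) simp
  moreover have "(\<lambda>(b, y). if b then f y else g y) \<in> borel_measurable (?B \<Otimes>\<^sub>M N)"
    by measurable
  ultimately show ?thesis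
    using enn_Lp_minkowski_integral[of ?B N "\<lambda>b y. if b then f y else g y" p] N p
    by (simp add: sum)
qed

text \<open>Jensen's inequality for the normalised measure; the power of the total mass \<open>c\<close> comes from undoing
the normalisation on both sides.\<close>

lemma enn_Lp_exponent_le:
  assumes "finite_measure M" and [measurable]: "f \<in> borel_measurable M"
    and c: "emeasure M (space M) = ennreal c" "0 < c" and p: "1 \<le> p'" "p' \<le> p"
  shows "enn_Lp M p' f \<le> ennreal (c powr (1 / p' - 1 / p)) * enn_Lp M p f"
proof -
  define \<mu> where "\<mu> = density M (\<lambda>x. ennreal (1 / c))"
  have "emeasure \<mu> (space \<mu>) = 1"
    using c by (simp add: \<mu>_def emeasure_density_const ennreal_mult[symmetric])
  then interpret \<mu>: prob_space \<mu> by (rule prob_spaceI)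
  have [measurable_cong]: "sets \<mu> = sets M" by (simp add: \<mu>_def)
  have int: "(\<integral>\<^sup>+x. h x \<partial>M) = ennreal c * (\<integral>\<^sup>+x. h x \<partial>\<mu>)" if [measurable]: "h \<in> borel_measurable M" for h
  proof -
    have "ennreal c * ennreal (1 / c) = 1"
      using c by (simp add: ennreal_mult[symmetric])
    then show ?thesis
      by (simp add: \<mu>_def nn_integral_density nn_integral_cmult mult.assoc[symmetric])
  qed
  have "ennpowr (\<integral>\<^sup>+x. ennpowr (f x) p' \<partial>\<mu>) (p / p') \<le> (\<integral>\<^sup>+x. ennpowr (ennpowr (f x) p') (p / p') \<partial>\<mu>)"
    using p by (intro \<mu>.nn_jensen) auto
  also have "\<dots> = (\<integral>\<^sup>+x. ennpowr (f x) p \<partial>\<mu>)"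
    using p by (simp add: ennpowr_ennpowr)
  finally have "ennpowr (ennpowr (\<integral>\<^sup>+x. ennpowr (f x) p' \<partial>\<mu>) (p / p')) (1 / p)
      \<le> ennpowr (\<integral>\<^sup>+x. ennpowr (f x) p \<partial>\<mu>) (1 / p)"
    using p by (intro ennpowr_mono) auto
  then have *: "enn_Lp \<mu> p' f \<le> enn_Lp \<mu> p f"
    using p by (simp add: enn_Lp_def ennpowr_ennpowr)
  have conv: "enn_Lp M r f = ennreal (c powr (1 / r)) * enn_Lp \<mu> r f" if "1 \<le> r" for r
    using that c by (simp add: enn_Lp_def int ennpowr_mult ennpowr_ennreal)
  have "enn_Lp M p' f \<le> ennreal (c powr (1 / p')) * enn_Lp \<mu> p f"
    using * p by (simp add: conv mult_left_mono)
  also have "\<dots> = ennreal (c powr (1 / p' - 1 / p)) * enn_Lp M p f"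
    using p c by (simp add: conv mult.assoc[symmetric] ennreal_mult[symmetric] powr_add[symmetric])
  finally show ?thesis .
qed

section \<open>Mixed norms\<close>

text \<open>The norm in \<open>L\<^sup>p(P; L\<^sup>q(N))\<close>, as an iterated norm. In this form an inequality for the mixed norm follows from the
inequality for the single norm, applied first to the inner and then to the outer one.\<close>

definition mixed_Lp :: "'s measure \<Rightarrow> 'w measure \<Rightarrow> real \<Rightarrow> real \<Rightarrow> ('s \<Rightarrow> 'w \<Rightarrow> ennreal) \<Rightarrow> ennreal" where
  "mixed_Lp N P p q f = enn_Lp P p (\<lambda>\<omega>. enn_Lp N q (\<lambda>s. f s \<omega>))"

context pair_sigma_finite
begin

lemma measurable_enn_Lp_fst:
  assumes f: "case_prod f \<in> borel_measurable (M1 \<Otimes>\<^sub>M M2)"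
  shows "(\<lambda>\<omega>. enn_Lp M1 q (\<lambda>s. f s \<omega>)) \<in> borel_measurable M2"
  by (rule M1.measurable_enn_Lp)
    (use measurable_pair_swap[OF f] in \<open>simp add: case_prod_unfold\<close>)

text \<open>The mixed norm integrates over \<open>M1\<close> inside, so the exceptional set has to be null in
the iterated sense with \<open>M2\<close> outside.\<close>

lemma mixed_Lp_mono_AE:
  assumes [measurable]: "case_prod f \<in> borel_measurable (M1 \<Otimes>\<^sub>M M2)" "case_prod g \<in> borel_measurable (M1 \<Otimes>\<^sub>M M2)"
    and "0 < p" "0 < q" and le: "AE (s, \<omega>) in M1 \<Otimes>\<^sub>M M2. f s \<omega> \<le> g s \<omega>"
  shows "mixed_Lp M1 M2 p q f \<le> mixed_Lp M1 M2 p q g"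
proof -
  have "AE s in M1. AE \<omega> in M2. f s \<omega> \<le> g s \<omega>"
    using AE_pair[OF le] by simp
  then have "AE \<omega> in M2. AE s in M1. f s \<omega> \<le> g s \<omega>"
    by (subst (asm) AE_commute) measurable
  then show ?thesis
    unfolding mixed_Lp_def using assms(3,4)
    by (intro enn_Lp_mono_AE) (auto elim!: eventually_mono intro: enn_Lp_mono_AE)
qed

lemma mixed_Lp_mono:
  assumes "0 < p" "0 < q" "\<And>s \<omega>. s \<in> space M1 \<Longrightarrow> \<omega> \<in> space M2 \<Longrightarrow> f s \<omega> \<le> g s \<omega>"
  shows "mixed_Lp M1 M2 p q f \<le> mixed_Lp M1 M2 p q g"
  unfolding mixed_Lp_def using assms by (intro enn_Lp_mono_AE AE_I2)

lemma mixed_Lp_eq_0_iff: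
  assumes [measurable]: "case_prod f \<in> borel_measurable (M1 \<Otimes>\<^sub>M M2)"
  shows "mixed_Lp M1 M2 p q f = 0 \<longleftrightarrow> (AE (s, \<omega>) in M1 \<Otimes>\<^sub>M M2. f s \<omega> = 0)"
proof -
  have [measurable]: "(\<lambda>s. f s \<omega>) \<in> borel_measurable M1" if "\<omega> \<in> space M2" for \<omega>
    using that by measurable
  have "mixed_Lp M1 M2 p q f = 0 \<longleftrightarrow> (AE \<omega> in M2. AE s in M1. f s \<omega> = 0)"
    unfolding mixed_Lp_def
    by (subst enn_Lp_eq_0_iff) (auto simp: measurable_enn_Lp_fst enn_Lp_eq_0_iff intro!: AE_cong)
  also have "\<dots> \<longleftrightarrow> (AE s in M1. AE \<omega> in M2. f s \<omega> = 0)"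
    by (subst AE_commute) measurable
  also have "\<dots> \<longleftrightarrow> (AE (s, \<omega>) in M1 \<Otimes>\<^sub>M M2. f s \<omega> = 0)"
    by (subst AE_pair_iff) (simp_all add: case_prod_unfold)
  finally show ?thesis .
qed

lemma AE_finite_if_mixed_Lp_finite:
  assumes [measurable]: "case_prod f \<in> borel_measurable (M1 \<Otimes>\<^sub>M M2)" and fin: "mixed_Lp M1 M2 p q f < \<top>"
  shows "AE (s, \<omega>) in M1 \<Otimes>\<^sub>M M2. f s \<omega> < \<top>"
proof -
  have [measurable]: "(\<lambda>s. f s \<omega>) \<in> borel_measurable M1" if "\<omega> \<in> space M2" for \<omega>
    using that by measurable
  have "AE \<omega> in M2. enn_Lp M1 q (\<lambda>s. f s \<omega>) < \<top>"
    using fin unfolding mixed_Lp_def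
    by (rule AE_finite_if_enn_Lp_finite[rotated]) (simp add: measurable_enn_Lp_fst)
  then have "AE \<omega> in M2. AE s in M1. f s \<omega> < \<top>"
    using AE_space by eventually_elim (auto intro: AE_finite_if_enn_Lp_finite)
  then have "AE s in M1. AE \<omega> in M2. f s \<omega> < \<top>"
    by (subst AE_commute) measurable
  then show ?thesis
    by (subst (asm) AE_pair_iff) (simp_all add: case_prod_unfold)
qed

lemma mixed_Lp_cmult:
  assumes [measurable]: "case_prod f \<in> borel_measurable (M1 \<Otimes>\<^sub>M M2)" and "0 < p" "0 < q"
  shows "mixed_Lp M1 M2 p q (\<lambda>s \<omega>. c * f s \<omega>) = c * mixed_Lp M1 M2 p q f"
proof -
  have "mixed_Lp M1 M2 p q (\<lambda>s \<omega>. c * f s \<omega>) = enn_Lp M2 p (\<lambda>\<omega>. c * enn_Lp M1 q (\<lambda>s. f s \<omega>))"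
    unfolding mixed_Lp_def using assms(3) by (intro enn_Lp_cong_AE AE_I2 enn_Lp_cmult) measurable
  also have "\<dots> = c * mixed_Lp M1 M2 p q f"
    unfolding mixed_Lp_def using assms(2) by (intro enn_Lp_cmult measurable_enn_Lp_fst) measurable
  finally show ?thesis .
qed

lemma mixed_Lp_triangle:
  assumes [measurable]: "case_prod f \<in> borel_measurable (M1 \<Otimes>\<^sub>M M2)" "case_prod g \<in> borel_measurable (M1 \<Otimes>\<^sub>M M2)"
    and pq: "1 \<le> p" "1 \<le> q"
  shows "mixed_Lp M1 M2 p q (\<lambda>s \<omega>. f s \<omega> + g s \<omega>) \<le> mixed_Lp M1 M2 p q f + mixed_Lp M1 M2 p q g"
proof -
  have "mixed_Lp M1 M2 p q (\<lambda>s \<omega>. f s \<omega> + g s \<omega>)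
      \<le> enn_Lp M2 p (\<lambda>\<omega>. enn_Lp M1 q (\<lambda>s. f s \<omega>) + enn_Lp M1 q (\<lambda>s. g s \<omega>))"
    unfolding mixed_Lp_def using pq
    by (intro enn_Lp_mono_AE AE_I2 enn_Lp_triangle M1.sigma_finite_measure_axioms) measurable
  also have "\<dots> \<le> mixed_Lp M1 M2 p q f + mixed_Lp M1 M2 p q g"
    unfolding mixed_Lp_def using pq
    by (intro enn_Lp_triangle M2.sigma_finite_measure_axioms measurable_enn_Lp_fst) measurable
  finally show ?thesis .
qed

theorem mixed_Lp_minkowski_integral:
  assumes M: "sigma_finite_measure M" and pq: "1 \<le> p" "1 \<le> q"
    and g [measurable]: "(\<lambda>(\<tau>, s, \<omega>). g \<tau> s \<omega>) \<in> borel_measurable (M \<Otimes>\<^sub>M (M1 \<Otimes>\<^sub>M M2))"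
  shows "mixed_Lp M1 M2 p q (\<lambda>s \<omega>. \<integral>\<^sup>+\<tau>. g \<tau> s \<omega> \<partial>M) \<le> (\<integral>\<^sup>+\<tau>. mixed_Lp M1 M2 p q (g \<tau>) \<partial>M)"
proof -
  interpret M: sigma_finite_measure M by fact
  have [measurable]: "(\<lambda>(\<tau>, s). g \<tau> s \<omega>) \<in> borel_measurable (M \<Otimes>\<^sub>M M1)" if "\<omega> \<in> space M2" for \<omega>
  proof -
    have "(\<lambda>(\<tau>, s). (\<tau>, s, \<omega>)) \<in> M \<Otimes>\<^sub>M M1 \<rightarrow>\<^sub>M M \<Otimes>\<^sub>M (M1 \<Otimes>\<^sub>M M2)"
      using that by measurable
    from measurable_compose[OF this g] show ?thesis
      by (simp add: case_prod_unfold)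
  qed
  have [measurable]: "(\<lambda>(\<tau>, \<omega>). enn_Lp M1 q (\<lambda>s. g \<tau> s \<omega>)) \<in> borel_measurable (M \<Otimes>\<^sub>M M2)"
  proof -
    have "(\<lambda>z. (fst (fst z), snd z, snd (fst z))) \<in> (M \<Otimes>\<^sub>M M2) \<Otimes>\<^sub>M M1 \<rightarrow>\<^sub>M M \<Otimes>\<^sub>M (M1 \<Otimes>\<^sub>M M2)"
      by measurable
    from measurable_compose[OF this g] show ?thesis
      unfolding case_prod_unfold by (intro M1.measurable_enn_Lp) (simp add: case_prod_unfold)
  qed
  have "mixed_Lp M1 M2 p q (\<lambda>s \<omega>. \<integral>\<^sup>+\<tau>. g \<tau> s \<omega> \<partial>M)
      \<le> enn_Lp M2 p (\<lambda>\<omega>. \<integral>\<^sup>+\<tau>. enn_Lp M1 q (\<lambda>s. g \<tau> s \<omega>) \<partial>M)"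
    unfolding mixed_Lp_def using pq
    by (intro enn_Lp_mono_AE AE_I2 enn_Lp_minkowski_integral M M1.sigma_finite_measure_axioms) auto
  also have "\<dots> \<le> (\<integral>\<^sup>+\<tau>. mixed_Lp M1 M2 p q (g \<tau>) \<partial>M)"
    unfolding mixed_Lp_def using pq
    by (intro enn_Lp_minkowski_integral M M2.sigma_finite_measure_axioms) auto
  finally show ?thesis .
qed

lemma mixed_Lp_exponent_le:
  assumes [measurable]: "case_prod f \<in> borel_measurable (M1 \<Otimes>\<^sub>M M2)"
    and M1: "finite_measure M1" "emeasure M1 (space M1) = ennreal c" "0 < c" and M2: "prob_space M2"
    and p: "1 \<le> p'" "p' \<le> p" and q: "1 \<le> q'" "q' \<le> q"
  shows "mixed_Lp M1 M2 p' q' f \<le> ennreal (c powr (1 / q' - 1 / q)) * mixed_Lp M1 M2 p q f"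
proof -
  interpret P: prob_space M2 by fact
  have "mixed_Lp M1 M2 p' q' f
      \<le> enn_Lp M2 p' (\<lambda>\<omega>. ennreal (c powr (1 / q' - 1 / q)) * enn_Lp M1 q (\<lambda>s. f s \<omega>))"
    unfolding mixed_Lp_def using p
    by (intro enn_Lp_mono_AE AE_I2 enn_Lp_exponent_le M1 q) measurable
  also have "\<dots> = ennreal (c powr (1 / q' - 1 / q)) * enn_Lp M2 p' (\<lambda>\<omega>. enn_Lp M1 q (\<lambda>s. f s \<omega>))"
    using p by (intro enn_Lp_cmult measurable_enn_Lp_fst) auto
  also have "enn_Lp M2 p' (\<lambda>\<omega>. enn_Lp M1 q (\<lambda>s. f s \<omega>)) \<le> ennreal (1 powr (1 / p' - 1 / p)) * mixed_Lp M1 M2 p q f"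
    unfolding mixed_Lp_def
    by (intro enn_Lp_exponent_le P.finite_measure_axioms measurable_enn_Lp_fst p)
      (auto simp: P.emeasure_space_1)
  finally show ?thesis by (simp add: mult_left_mono)
qed

text \<open>Dominated convergence, used for the inner norm at almost every \<open>\<omega>\<close> and then for the outer norm; the norm
without the indicator dominates both times.\<close>

lemma mixed_Lp_indicator_tendsto_0:
  fixes A :: "nat \<Rightarrow> 'a set"
  assumes [measurable]: "case_prod f \<in> borel_measurable (M1 \<Otimes>\<^sub>M M2)" "\<And>n. A n \<in> sets M1"
    and fin: "mixed_Lp M1 M2 p q f < \<top>" and pq: "0 < p" "0 < q"
    and A: "AE s in M1. \<forall>\<^sub>F n in sequentially. s \<notin> A n"
  shows "(\<lambda>n. mixed_Lp M1 M2 p q (\<lambda>s \<omega>. indicator (A n) s * f s \<omega>)) \<longlonglongrightarrow> 0"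
proof -
  let ?f = "\<lambda>n s \<omega>. indicator (A n) s * f s \<omega>"
  have sec [measurable]: "(\<lambda>s. f s \<omega>) \<in> borel_measurable M1" if "\<omega> \<in> space M2" for \<omega>
    using that by measurable
  have le: "enn_Lp M1 q (\<lambda>s. ?f n s \<omega>) \<le> enn_Lp M1 q (\<lambda>s. f s \<omega>)" for n \<omega>
    using pq by (intro enn_Lp_mono_AE) (auto simp: indicator_def)
  have inner: "(\<lambda>n. enn_Lp M1 q (\<lambda>s. ?f n s \<omega>)) \<longlonglongrightarrow> 0"
    if "\<omega> \<in> space M2" "enn_Lp M1 q (\<lambda>s. f s \<omega>) < \<top>" for \<omega>
  proof -
    have "(\<lambda>n. \<integral>\<^sup>+s. ennpowr (?f n s \<omega>) q \<partial>M1) \<longlonglongrightarrow> (\<integral>\<^sup>+s. 0 \<partial>M1)"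
    proof (rule nn_integral_dominated_convergence)
      show "AE s in M1. ennpowr (?f n s \<omega>) q \<le> ennpowr (f s \<omega>) q" for n
        using pq by (intro AE_I2 ennpowr_mono) (auto simp: indicator_def)
      show "(\<integral>\<^sup>+s. ennpowr (f s \<omega>) q \<partial>M1) < \<infinity>"
        using that(2) by (simp add: enn_Lp_def)
      show "AE s in M1. (\<lambda>n. ennpowr (?f n s \<omega>) q) \<longlonglongrightarrow> 0"
        using A
      proof eventually_elim
        case (elim s)
        then show ?case
          by (intro tendsto_eventually) (auto elim!: eventually_mono)
      qed
    qed (use that(1) in measurable)
    then show ?thesis
      unfolding enn_Lp_def using pq by (intro tendsto_ennpowr_0) auto
  qed
  have [measurable]: "(\<lambda>\<omega>. enn_Lp M1 q (\<lambda>s. f s \<omega>)) \<in> borel_measurable M2"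
      "(\<lambda>\<omega>. enn_Lp M1 q (\<lambda>s. ?f n s \<omega>)) \<in> borel_measurable M2" for n
    by (intro measurable_enn_Lp_fst; measurable)+
  have "(\<lambda>n. \<integral>\<^sup>+\<omega>. ennpowr (enn_Lp M1 q (\<lambda>s. ?f n s \<omega>)) p \<partial>M2) \<longlonglongrightarrow> (\<integral>\<^sup>+\<omega>. 0 \<partial>M2)"
  proof (rule nn_integral_dominated_convergence)
    show "AE \<omega> in M2. ennpowr (enn_Lp M1 q (\<lambda>s. ?f n s \<omega>)) p \<le> ennpowr (enn_Lp M1 q (\<lambda>s. f s \<omega>)) p" for n
      using pq by (intro AE_I2 ennpowr_mono le) auto
    show "(\<integral>\<^sup>+\<omega>. ennpowr (enn_Lp M1 q (\<lambda>s. f s \<omega>)) p \<partial>M2) < \<infinity>"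
      using fin by (simp add: mixed_Lp_def enn_Lp_def[of M2])
    have "AE \<omega> in M2. enn_Lp M1 q (\<lambda>s. f s \<omega>) < \<top>"
      by (rule AE_finite_if_enn_Lp_finite) (use fin in \<open>auto simp: mixed_Lp_def\<close>)
    then show "AE \<omega> in M2. (\<lambda>n. ennpowr (enn_Lp M1 q (\<lambda>s. ?f n s \<omega>)) p) \<longlonglongrightarrow> 0"
      using AE_space by eventually_elim (use pq in \<open>auto intro!: tendsto_ennpowr_0 inner\<close>)
  qed measurable
  then show ?thesis
    unfolding mixed_Lp_def enn_Lp_def[of M2] using pq by (intro tendsto_ennpowr_0) auto
qed

end

section \<open>Integrals over time intervals\<close>

abbreviation leb_on :: "real \<Rightarrow> real \<Rightarrow> real measure" where
  "leb_on a b \<equiv> restrict_space lborel {a..b}"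

lemma Lpq_norm_eq_mixed_Lp:
  assumes "0 < p" "0 < q"
  shows "Lpq_norm P p q a b \<phi> = mixed_Lp (leb_on a b) P p q (\<lambda>s \<omega>. ennreal (norm (\<phi> s \<omega>)))"
  using assms unfolding Lpq_norm_def mixed_Lp_def enn_Lp_def
  by (simp add: ennpowr_ennpowr nn_integral_restrict_space ennpowr_ennreal)

text \<open>This replaces a change of the time interval by an indicator, so that norms over different subintervals
can be compared as mixed norms over one fixed space.\<close>

lemma mixed_Lp_subinterval:
  assumes "0 < p" "0 < q" "{c..d} \<subseteq> {a..b}"
  shows "mixed_Lp (leb_on c d) P p q f = mixed_Lp (leb_on a b) P p q (\<lambda>s \<omega>. indicator {c..d} s * f s \<omega>)"
proof -
  have "ennpowr (indicator {c..d} s * x) q * indicator {a..b} s = ennpowr x q * indicator {c..d} s" for s x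
    using assms by (auto simp: indicator_def)
  then show ?thesis
    unfolding mixed_Lp_def enn_Lp_def by (simp add: nn_integral_restrict_space)
qed

lemma space_leb_on [simp]: "space (leb_on a b) = {a..b}"
  by (simp add: space_restrict_space)

lemma sets_leb_on_eq_borel [measurable_cong]: "sets (leb_on a b) = sets (restrict_space borel {a..b})"
  by (simp add: sets_restrict_space)

lemma measurable_leb_on_id [measurable]: "(\<lambda>x. x) \<in> borel_measurable (leb_on a b)"
  by (rule measurable_restrict_space1) simp

lemma emeasure_leb_on_Icc: "a \<le> c \<Longrightarrow> c \<le> d \<Longrightarrow> d \<le> b \<Longrightarrow> emeasure (leb_on a b) {c..d} = ennreal (d - c)"
  by (subst emeasure_restrict_space) auto

lemma Icc_in_sets_leb_on: "{c..d} \<inter> {a..b} \<in> sets (leb_on a b)"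
  by (auto simp: sets_restrict_space)

lemma finite_measure_leb_on: "finite_measure (leb_on a b)"
  by (rule finite_measureI) (simp add: emeasure_restrict_space emeasure_lborel_Icc_eq)

lemma sigma_finite_leb_on: "sigma_finite_measure (leb_on a b)"
  by (rule finite_measure.axioms(1)[OF finite_measure_leb_on])

lemma set_integrable_iff_leb_on: 
  fixes f :: "real \<Rightarrow> 'h::euclidean_space"
  shows "set_integrable lborel {a..b} f \<longleftrightarrow> integrable (leb_on a b) f"
  by (simp add: set_integrable_def integrable_restrict_space)

lemma set_integral_eq_leb_on:
  fixes f :: "real \<Rightarrow> 'h::euclidean_space"
  assumes "c \<le> b"
  shows "(LINT \<tau>:{a..c}|lborel. f \<tau>) = (LINT \<tau>|leb_on a b. indicator {a..c} \<tau> *\<^sub>R f \<tau>)"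
proof -
  have "indicator {a..b} x *\<^sub>R indicator {a..c} x *\<^sub>R f x = indicator {a..c} x *\<^sub>R f x" for x
    using assms by (auto simp: indicator_def)
  then show ?thesis
    unfolding set_lebesgue_integral_def by (subst integral_restrict_space) (simp_all del: scaleR_scaleR)
qed

text \<open>The left-hand side is the norm of the integral of \<open>f - v\<close> between \<open>a\<close> and \<open>b\<close>. It is used with \<open>v\<close> the value at
\<open>a\<close>, for the derivative of the integral, and with \<open>v = 0\<close>, for the size of an increment.\<close>

lemma norm_increment_set_integral_le:
  fixes f :: "real \<Rightarrow> 'h::euclidean_space"
  assumes int: "set_integrable lborel {S..T} f" and ab: "a \<in> {S..T}" "b \<in> {S..T}"
  shows "ennreal (norm ((LINT \<tau>:{S..b}|lborel. f \<tau>) - (LINT \<tau>:{S..a}|lborel. f \<tau>) - (b - a) *\<^sub>R v))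
    \<le> (\<integral>\<^sup>+\<tau>. indicator {min a b..max a b} \<tau> * ennreal (norm (f \<tau> - v)) \<partial>leb_on S T)"
  using ab
proof (induction a b rule: linorder_wlog)
  case (sym a b)
  have flip: "norm (x - y - (a - b) *\<^sub>R v) = norm (y - x - (b - a) *\<^sub>R v)" for x y
    by (subst norm_minus_cancel[symmetric]) (simp add: algebra_simps)
  show ?case
    using sym by (simp add: flip min.commute max.commute)
next
  case (le a b)
  have i1: "set_integrable lborel {S..a} f" and i2: "set_integrable lborel {a<..b} f"
    by (rule set_integrable_subset[OF int]; use le in auto)+
  have i3: "set_integrable lborel {a<..b} (\<lambda>_. v)"
    unfolding set_integrable_def using le by (intro integrable_scaleR_left integrable_real_indicator) auto
  have "{S..b} = {S..a} \<union> {a<..b}" "{S..a} \<inter> {a<..b} = {}" using le by auto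
  then have 1: "(LINT \<tau>:{S..b}|lborel. f \<tau>) - (LINT \<tau>:{S..a}|lborel. f \<tau>) = (LINT \<tau>:{a<..b}|lborel. f \<tau>)"
    using set_integral_Un[OF _ i1 i2] by simp
  have 2: "(b - a) *\<^sub>R v = (LINT \<tau>:{a<..b}|lborel. v)"
    using le unfolding set_lebesgue_integral_def by (subst integral_scaleR_left) auto
  have "ennreal (norm ((LINT \<tau>:{S..b}|lborel. f \<tau>) - (LINT \<tau>:{S..a}|lborel. f \<tau>) - (b - a) *\<^sub>R v))
      = ennreal (norm (LINT \<tau>:{a<..b}|lborel. f \<tau> - v))"
    by (simp only: 1 2 set_integral_diff(2)[OF i2 i3])
  also have "\<dots> \<le> (\<integral>\<^sup>+\<tau>. ennreal (norm (indicator {a<..b} \<tau> *\<^sub>R (f \<tau> - v))) \<partial>lborel)"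
    using set_integral_diff(1)[OF i2 i3] unfolding set_lebesgue_integral_def set_integrable_def
    by (rule integral_norm_bound_ennreal)
  also have "\<dots> \<le> (\<integral>\<^sup>+\<tau>. indicator {a..b} \<tau> * ennreal (norm (f \<tau> - v)) * indicator {S..T} \<tau> \<partial>lborel)"
    using le by (intro nn_integral_mono) (auto simp: indicator_def)
  also have "\<dots> = (\<integral>\<^sup>+\<tau>. indicator {min a b..max a b} \<tau> * ennreal (norm (f \<tau> - v)) \<partial>leb_on S T)"
    using le by (simp add: nn_integral_restrict_space)
  finally show ?case .
qed

text \<open>This holds for every \<open>f\<close>, since the Bochner integral of a function that is not integrable is 0.\<close>

lemma norm_set_integral_le_nn_integral:
  fixes f :: "real \<Rightarrow> 'h::euclidean_space"
  assumes "c \<le> b"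
  shows "ennreal (norm (LINT \<tau>:{a..c}|lborel. f \<tau>)) \<le> (\<integral>\<^sup>+\<tau>. ennreal (norm (f \<tau>)) \<partial>leb_on a b)"
proof -
  let ?g = "\<lambda>\<tau>. indicator {a..c} \<tau> *\<^sub>R f \<tau>"
  have "ennreal (norm (integral\<^sup>L (leb_on a b) ?g)) \<le> (\<integral>\<^sup>+\<tau>. ennreal (norm (?g \<tau>)) \<partial>leb_on a b)"
  proof (cases "integrable (leb_on a b) ?g")
    case False
    then have "integral\<^sup>L (leb_on a b) ?g = 0" by (rule not_integrable_integral_eq)
    then show ?thesis by (simp del: norm_scaleR)
  qed (rule integral_norm_bound_ennreal)
  also have "\<dots> \<le> (\<integral>\<^sup>+\<tau>. ennreal (norm (f \<tau>)) \<partial>leb_on a b)"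
    by (intro nn_integral_mono) (auto simp: indicator_def)
  finally show ?thesis using assms by (simp add: set_integral_eq_leb_on)
qed

text \<open>The variable upper limit is moved into an indicator, which is jointly measurable in \<open>\<tau>\<close> and \<open>z\<close>.\<close>

lemma measurable_partial_integral:
  fixes f :: "real \<Rightarrow> 'z \<Rightarrow> 'h::euclidean_space"
  assumes f: "(\<lambda>(\<tau>, z). f \<tau> z) \<in> borel_measurable (leb_on S T \<Otimes>\<^sub>M Q)"
    and u [measurable]: "u \<in> borel_measurable Q" and le: "\<And>z. z \<in> space Q \<Longrightarrow> u z \<le> T"
  shows "(\<lambda>z. LINT \<tau>:{S..u z}|lborel. f \<tau> z) \<in> borel_measurable Q"
proof -
  interpret L: sigma_finite_measure "leb_on S T" by (rule sigma_finite_leb_on)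
  have [measurable]: "(\<lambda>x. f (snd x) (fst x)) \<in> borel_measurable (Q \<Otimes>\<^sub>M leb_on S T)"
    using measurable_pair_swap[OF f] by (simp add: case_prod_unfold)
  have "(\<lambda>z. LINT \<tau>|leb_on S T. indicator {\<tau>. S \<le> \<tau> \<and> \<tau> \<le> u z} \<tau> *\<^sub>R f \<tau> z) \<in> borel_measurable Q"
    by (rule L.borel_measurable_lebesgue_integral) (simp add: case_prod_unfold)
  then show ?thesis
    by (subst measurable_cong[OF set_integral_eq_leb_on[where b = T]]) (simp_all add: le atLeastAtMost_def atLeast_def atMost_def Collect_conj_eq)
qed

section \<open>The fundamental theorem of calculus in the mixed norm\<close>

text \<open>What remains of \<open>Z \<in> C\<^sup>1([S,T]; L\<^sup>p\<^sup>,\<^sup>q)\<close> after progressive measurability is replaced by measurability with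
respect to the product \<open>\<sigma>\<close>-field. All norm estimates are proved in this setting,
where the filtration does not occur.\<close>

locale C1_process = prob_space P for P :: "'w measure" +
  fixes p q S T :: real and Z DZ :: "real \<Rightarrow> real \<Rightarrow> 'w \<Rightarrow> 'h::euclidean_space"
  assumes p: "1 \<le> p" and q: "1 \<le> q" and ST: "S < T"
    and measurable_Z: "\<And>t. t \<in> {S..T} \<Longrightarrow> case_prod (Z t) \<in> borel_measurable (leb_on S T \<Otimes>\<^sub>M P)"
    and measurable_DZ: "(\<lambda>(\<tau>, s, \<omega>). DZ \<tau> s \<omega>) \<in> borel_measurable (leb_on S T \<Otimes>\<^sub>M (leb_on S T \<Otimes>\<^sub>M P))"
    and finite_Z: "\<And>t. t \<in> {S..T} \<Longrightarrow> Lpq_norm P p q S T (Z t) < \<top>"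
    and finite_DZ: "\<And>t. t \<in> {S..T} \<Longrightarrow> Lpq_norm P p q S T (DZ t) < \<top>"
    and continuous_DZ: "\<And>t. t \<in> {S..T} \<Longrightarrow>
      ((\<lambda>r. Lpq_norm P p q S T (\<lambda>s \<omega>. DZ r s \<omega> - DZ t s \<omega>)) \<longlongrightarrow> 0) (at t within {S..T})"
    and has_derivative_Z: "\<And>t. t \<in> {S..T} \<Longrightarrow>
      ((\<lambda>r. Lpq_norm P p q S T (\<lambda>s \<omega>. (Z r s \<omega> - Z t s \<omega>) /\<^sub>R (r - t) - DZ t s \<omega>)) \<longlongrightarrow> 0)
        (at t within {S..T})"
begin

abbreviation L where "L \<equiv> leb_on S T"
abbreviation mixed where "mixed \<equiv> mixed_Lp L P p q"
abbreviation nrm :: "(real \<Rightarrow> 'w \<Rightarrow> 'h) \<Rightarrow> ennreal" where "nrm \<equiv> Lpq_norm P p q S T"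

sublocale time: finite_measure L by (rule finite_measure_leb_on)
sublocale TP: pair_sigma_finite L P ..

lemma pq_pos: "0 < p" "0 < q"
  using p q by auto

lemma nrm_eq: "nrm \<phi> = mixed (\<lambda>s \<omega>. ennreal (norm (\<phi> s \<omega>)))"
  by (rule Lpq_norm_eq_mixed_Lp) (use p q in auto)

lemma nrm_triangle:
  assumes [measurable]: "case_prod \<phi> \<in> borel_measurable (L \<Otimes>\<^sub>M P)" "case_prod \<psi> \<in> borel_measurable (L \<Otimes>\<^sub>M P)"
  shows "nrm \<phi> \<le> nrm \<psi> + nrm (\<lambda>s \<omega>. \<phi> s \<omega> - \<psi> s \<omega>)"
proof -
  have "nrm \<phi> \<le> mixed (\<lambda>s \<omega>. ennreal (norm (\<psi> s \<omega>)) + ennreal (norm (\<phi> s \<omega> - \<psi> s \<omega>)))"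
    unfolding nrm_eq
  proof (intro TP.mixed_Lp_mono pq_pos)
    show "ennreal (norm (\<phi> s \<omega>)) \<le> ennreal (norm (\<psi> s \<omega>)) + ennreal (norm (\<phi> s \<omega> - \<psi> s \<omega>))" for s \<omega>
      using norm_triangle_sub[of "\<phi> s \<omega>" "\<psi> s \<omega>"]
      by (simp add: ennreal_plus[symmetric] ennreal_leI del: ennreal_plus)
  qed
  also have "\<dots> \<le> nrm \<psi> + nrm (\<lambda>s \<omega>. \<phi> s \<omega> - \<psi> s \<omega>)"
    unfolding nrm_eq by (intro TP.mixed_Lp_triangle p q) measurable
  finally show ?thesis .
qed

lemma nrm_minus_commute: "nrm (\<lambda>s \<omega>. \<phi> s \<omega> - \<psi> s \<omega>) = nrm (\<lambda>s \<omega>. \<psi> s \<omega> - \<phi> s \<omega>)"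
  unfolding nrm_eq by (simp add: norm_minus_commute)

lemma nrm_diff_finite:
  assumes [measurable]: "case_prod \<phi> \<in> borel_measurable (L \<Otimes>\<^sub>M P)" "case_prod \<psi> \<in> borel_measurable (L \<Otimes>\<^sub>M P)"
    and "nrm \<phi> < \<top>" "nrm \<psi> < \<top>"
  shows "nrm (\<lambda>s \<omega>. \<phi> s \<omega> - \<psi> s \<omega>) < \<top>"
proof -
  have [measurable]: "case_prod (\<lambda>s \<omega>. - \<psi> s \<omega>) \<in> borel_measurable (L \<Otimes>\<^sub>M P)"
    unfolding case_prod_unfold by measurable
  have "nrm (\<lambda>s \<omega>. \<phi> s \<omega> - \<psi> s \<omega>) \<le> nrm (\<lambda>s \<omega>. - \<psi> s \<omega>) + nrm (\<lambda>s \<omega>. (\<phi> s \<omega> - \<psi> s \<omega>) - (- \<psi> s \<omega>))"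
    by (intro nrm_triangle) measurable
  also have "nrm (\<lambda>s \<omega>. - \<psi> s \<omega>) = nrm \<psi>" by (simp add: nrm_eq)
  also have "nrm \<psi> + nrm (\<lambda>s \<omega>. (\<phi> s \<omega> - \<psi> s \<omega>) - (- \<psi> s \<omega>)) < \<top>" using assms by simp
  finally show ?thesis .
qed

lemma measurable_DZ_at: "t \<in> {S..T} \<Longrightarrow> case_prod (DZ t) \<in> borel_measurable (L \<Otimes>\<^sub>M P)"
  using measurable_compose[OF measurable_Pair1' measurable_DZ, of t] by (simp add: case_prod_unfold)

lemma measurable_DZ_section:
  assumes "s \<in> {S..T}" "\<omega> \<in> space P"
  shows "(\<lambda>\<tau>. DZ \<tau> s \<omega>) \<in> borel_measurable L"
  using measurable_compose[OF measurable_Pair2' measurable_DZ, of "(s, \<omega>)"] assms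
  by (simp add: space_pair_measure)

lemma measurable_norm_DZ_diff [measurable]:
  assumes "case_prod \<psi> \<in> borel_measurable (L \<Otimes>\<^sub>M P)"
  shows "(\<lambda>(\<tau>, s, \<omega>). ennreal (norm (DZ \<tau> s \<omega> - \<psi> s \<omega>))) \<in> borel_measurable (L \<Otimes>\<^sub>M (L \<Otimes>\<^sub>M P))"
proof -
  have [measurable]: "(\<lambda>x. DZ (fst x) (fst (snd x)) (snd (snd x))) \<in> borel_measurable (L \<Otimes>\<^sub>M (L \<Otimes>\<^sub>M P))"
    using measurable_DZ by (simp add: case_prod_unfold)
  have [measurable]: "(\<lambda>x. \<psi> (fst (snd x)) (snd (snd x))) \<in> borel_measurable (L \<Otimes>\<^sub>M (L \<Otimes>\<^sub>M P))"
    using measurable_compose[OF measurable_snd assms] by (simp add: case_prod_unfold)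
  show ?thesis unfolding case_prod_unfold by measurable
qed

lemma measurable_norm_DZ [measurable]:
  "(\<lambda>(\<tau>, s, \<omega>). ennreal (norm (DZ \<tau> s \<omega>))) \<in> borel_measurable (L \<Otimes>\<^sub>M (L \<Otimes>\<^sub>M P))"
  using measurable_norm_DZ_diff[of "\<lambda>_ _. 0"] by simp

lemma measurable_nn_integral_L:
  assumes "(\<lambda>(\<tau>, s, \<omega>). g \<tau> s \<omega>) \<in> borel_measurable (L \<Otimes>\<^sub>M (L \<Otimes>\<^sub>M P))"
  shows "case_prod (\<lambda>s \<omega>. \<integral>\<^sup>+\<tau>. g \<tau> s \<omega> \<partial>L) \<in> borel_measurable (L \<Otimes>\<^sub>M P)"
  using time.borel_measurable_nn_integral[of "\<lambda>z \<tau>. g \<tau> (fst z) (snd z)" "L \<Otimes>\<^sub>M P"] measurable_pair_swap[OF assms]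
  by (simp add: case_prod_unfold)

lemma measurable_indicator_fst:
  assumes "(\<lambda>(\<tau>, s, \<omega>). g \<tau> s \<omega>) \<in> borel_measurable (L \<Otimes>\<^sub>M (L \<Otimes>\<^sub>M P))"
  shows "(\<lambda>(\<tau>, s, \<omega>). indicator {a..b::real} \<tau> * (g \<tau> s \<omega> :: ennreal)) \<in> borel_measurable (L \<Otimes>\<^sub>M (L \<Otimes>\<^sub>M P))"
proof -
  have [measurable]: "(\<lambda>x. g (fst x) (fst (snd x)) (snd (snd x))) \<in> borel_measurable (L \<Otimes>\<^sub>M (L \<Otimes>\<^sub>M P))"
    using assms by (simp add: case_prod_unfold)
  show ?thesis unfolding case_prod_unfold by measurable
qed

text \<open>Minkowski's integral inequality over a time interval, with a uniform bound on the integrand.\<close>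

lemma mixed_integral_interval_le:
  assumes g: "(\<lambda>(\<tau>, s, \<omega>). g \<tau> s \<omega>) \<in> borel_measurable (L \<Otimes>\<^sub>M (L \<Otimes>\<^sub>M P))"
    and ab: "S \<le> a" "a \<le> b" "b \<le> T" and C: "\<And>\<tau>. \<tau> \<in> {a..b} \<Longrightarrow> mixed (g \<tau>) \<le> C"
  shows "mixed (\<lambda>s \<omega>. \<integral>\<^sup>+\<tau>. indicator {a..b} \<tau> * g \<tau> s \<omega> \<partial>L) \<le> C * ennreal (b - a)"
proof -
  have [measurable]: "case_prod (g \<tau>) \<in> borel_measurable (L \<Otimes>\<^sub>M P)" if "\<tau> \<in> {S..T}" for \<tau>
    using measurable_compose[OF measurable_Pair1' g, of \<tau>] that by (simp add: case_prod_unfold)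
  have "mixed (\<lambda>s \<omega>. \<integral>\<^sup>+\<tau>. indicator {a..b} \<tau> * g \<tau> s \<omega> \<partial>L)
      \<le> (\<integral>\<^sup>+\<tau>. mixed (\<lambda>s \<omega>. indicator {a..b} \<tau> * g \<tau> s \<omega>) \<partial>L)"
    by (intro TP.mixed_Lp_minkowski_integral sigma_finite_leb_on p q measurable_indicator_fst g)
  also have "\<dots> \<le> (\<integral>\<^sup>+\<tau>. C * indicator {a..b} \<tau> \<partial>L)"
  proof (rule nn_integral_mono)
    fix \<tau> assume "\<tau> \<in> space L"
    then have "mixed (\<lambda>s \<omega>. indicator {a..b} \<tau> * g \<tau> s \<omega>) = indicator {a..b} \<tau> * mixed (g \<tau>)"
      by (intro TP.mixed_Lp_cmult pq_pos) auto
    also have "\<dots> \<le> C * indicator {a..b} \<tau>"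
      using C by (auto simp: indicator_def)
    finally show "mixed (\<lambda>s \<omega>. indicator {a..b} \<tau> * g \<tau> s \<omega>) \<le> C * indicator {a..b} \<tau>" .
  qed
  also have "\<dots> = C * emeasure L {a..b}"
    using ab Icc_in_sets_leb_on[of a b S T] by (intro nn_integral_cmult_indicator) (simp add: Int_absorb2)
  finally show ?thesis using ab by (simp add: emeasure_leb_on_Icc)
qed

text \<open>By the triangle inequality, the norm of \<open>DZ t\<close> is a continuous real function of \<open>t\<close> on a compact
interval.\<close>

lemma bounded_nrm_DZ: "\<exists>K\<ge>0. \<forall>t\<in>{S..T}. nrm (DZ t) \<le> ennreal K"
proof -
  let ?n = "\<lambda>t. enn2real (nrm (DZ t))"
  have "continuous_on {S..T} ?n"
    unfolding continuous_on_def
  proof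
    fix t assume t: "t \<in> {S..T}"
    have "((\<lambda>r. enn2real (nrm (\<lambda>s \<omega>. DZ r s \<omega> - DZ t s \<omega>))) \<longlongrightarrow> 0) (at t within {S..T})"
      using tendsto_enn2real[OF continuous_DZ[OF t, unfolded ennreal_0[symmetric]]] by simp
    moreover have "\<forall>\<^sub>F r in at t within {S..T}. norm (?n r - ?n t) \<le> enn2real (nrm (\<lambda>s \<omega>. DZ r s \<omega> - DZ t s \<omega>))"
      unfolding eventually_at_filter
    proof (intro always_eventually allI impI)
      fix r assume r: "r \<in> {S..T}"
      have fin: "nrm (\<lambda>s \<omega>. DZ r s \<omega> - DZ t s \<omega>) < \<top>"
        using r t by (intro nrm_diff_finite measurable_DZ_at finite_DZ)
      have "?n r \<le> enn2real (nrm (DZ t) + nrm (\<lambda>s \<omega>. DZ r s \<omega> - DZ t s \<omega>))"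
        using r t fin finite_DZ[OF t] by (intro enn2real_mono nrm_triangle measurable_DZ_at) auto
      moreover have "?n t \<le> enn2real (nrm (DZ r) + nrm (\<lambda>s \<omega>. DZ r s \<omega> - DZ t s \<omega>))"
        using r t fin finite_DZ[OF r] nrm_triangle[OF measurable_DZ_at measurable_DZ_at, OF t r]
        by (intro enn2real_mono) (auto simp: nrm_minus_commute[of "DZ t"])
      ultimately show "norm (?n r - ?n t) \<le> enn2real (nrm (\<lambda>s \<omega>. DZ r s \<omega> - DZ t s \<omega>))"
        using fin finite_DZ[OF r] finite_DZ[OF t] by (simp add: enn2real_plus abs_le_iff)
    qed
    ultimately have "((\<lambda>r. ?n r - ?n t) \<longlongrightarrow> 0) (at t within {S..T})"
      by (rule Lim_null_comparison[rotated])
    then show "(?n \<longlongrightarrow> ?n t) (at t within {S..T})"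
      by (simp add: LIM_zero_iff)
  qed
  then have "bounded (?n ` {S..T})"
    by (intro compact_imp_bounded compact_continuous_image) auto
  then obtain K where K: "0 < K" "\<And>t. t \<in> {S..T} \<Longrightarrow> ?n t \<le> K"
    by (auto simp: bounded_pos)
  then have "nrm (DZ t) \<le> ennreal K" if "t \<in> {S..T}" for t
    using finite_DZ[OF that] K(2)[OF that] by (metis ennreal_enn2real ennreal_leI)
  then show ?thesis using K(1) by (intro exI[of _ K]) auto
qed

text \<open>The pathwise integral of the norm of \<open>DZ\<close> has finite mixed norm, so it is finite almost
everywhere. Hence the second branch in the definition of the diagonal is taken on a null set only.\<close>

lemma AE_set_integrable_DZ: "AE (s, \<omega>) in L \<Otimes>\<^sub>M P. set_integrable lborel {S..T} (\<lambda>\<tau>. DZ \<tau> s \<omega>)"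
proof -
  obtain K where K: "\<forall>t\<in>{S..T}. nrm (DZ t) \<le> ennreal K" using bounded_nrm_DZ by auto
  let ?G = "\<lambda>s \<omega>. \<integral>\<^sup>+\<tau>. indicator {S..T} \<tau> * ennreal (norm (DZ \<tau> s \<omega>)) \<partial>L"
  have "mixed ?G \<le> ennreal K * ennreal (T - S)"
    using ST K by (intro mixed_integral_interval_le measurable_norm_DZ) (auto simp: nrm_eq[symmetric])
  also have "\<dots> < \<top>" by (simp add: ennreal_mult_less_top)
  finally have "AE (s, \<omega>) in L \<Otimes>\<^sub>M P. ?G s \<omega> < \<top>"
    by (intro TP.AE_finite_if_mixed_Lp_finite measurable_nn_integral_L measurable_indicator_fst measurable_norm_DZ)
  then show ?thesis
    using AE_space
  proof eventually_elim
    case (elim z)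
    obtain s \<omega> where z: "z = (s, \<omega>)" by force
    have "(\<integral>\<^sup>+\<tau>. ennreal (norm (DZ \<tau> s \<omega>)) \<partial>L) = ?G s \<omega>"
      by (intro nn_integral_cong) auto
    then show ?case
      using elim measurable_DZ_section[of s \<omega>]
      by (auto simp: z set_integrable_iff_leb_on integrable_iff_bounded space_pair_measure)
  qed
qed

abbreviation int_DZ where "int_DZ \<equiv> (\<lambda>t s \<omega>. LINT \<tau>:{S..t}|lborel. DZ \<tau> s \<omega>)"

lemma measurable_int_DZ: "t \<le> T \<Longrightarrow> case_prod (int_DZ t) \<in> borel_measurable (L \<Otimes>\<^sub>M P)"
  using measurable_partial_integral[of "\<lambda>\<tau> z. DZ \<tau> (fst z) (snd z)" S T "L \<Otimes>\<^sub>M P" "\<lambda>_. t"] measurable_DZ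
  by (simp add: case_prod_unfold)

lemma nrm_int_DZ_finite:
  assumes "t \<in> {S..T}"
  shows "nrm (int_DZ t) < \<top>"
proof -
  obtain K where K: "\<forall>t\<in>{S..T}. nrm (DZ t) \<le> ennreal K" using bounded_nrm_DZ by auto
  have "nrm (int_DZ t) \<le> mixed (\<lambda>s \<omega>. \<integral>\<^sup>+\<tau>. indicator {S..T} \<tau> * ennreal (norm (DZ \<tau> s \<omega>)) \<partial>L)"
    unfolding nrm_eq
  proof (intro TP.mixed_Lp_mono pq_pos)
    fix s \<omega>
    have "ennreal (norm (int_DZ t s \<omega>)) \<le> (\<integral>\<^sup>+\<tau>. ennreal (norm (DZ \<tau> s \<omega>)) \<partial>L)"
      using assms by (intro norm_set_integral_le_nn_integral) auto
    also have "\<dots> = (\<integral>\<^sup>+\<tau>. indicator {S..T} \<tau> * ennreal (norm (DZ \<tau> s \<omega>)) \<partial>L)"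
      by (intro nn_integral_cong) auto
    finally show "ennreal (norm (int_DZ t s \<omega>)) \<le> (\<integral>\<^sup>+\<tau>. indicator {S..T} \<tau> * ennreal (norm (DZ \<tau> s \<omega>)) \<partial>L)" .
  qed
  also have "\<dots> \<le> ennreal K * ennreal (T - S)"
    using ST K by (intro mixed_integral_interval_le measurable_norm_DZ) (auto simp: nrm_eq[symmetric])
  also have "\<dots> < \<top>" by (simp add: ennreal_mult_less_top)
  finally show ?thesis .
qed

abbreviation remainder where "remainder \<equiv> (\<lambda>t s \<omega>. Z t s \<omega> - Z S s \<omega> - int_DZ t s \<omega>)"

lemma measurable_remainder:
  assumes "t \<in> {S..T}"
  shows "case_prod (remainder t) \<in> borel_measurable (L \<Otimes>\<^sub>M P)"
  using borel_measurable_diff[OF borel_measurable_diff[OF measurable_Z[OF assms] measurable_Z[of S]] measurable_int_DZ[of t]] assms ST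
  by (simp add: case_prod_unfold)

lemma measurable_norm_process:
  "case_prod \<phi> \<in> borel_measurable (L \<Otimes>\<^sub>M P) \<Longrightarrow>
    case_prod (\<lambda>s \<omega>. ennreal (norm (\<phi> s \<omega> :: 'h))) \<in> borel_measurable (L \<Otimes>\<^sub>M P)"
  using measurable_compose[of "case_prod \<phi>" "L \<Otimes>\<^sub>M P" borel "\<lambda>x. ennreal (norm x)" borel]
  by (simp add: case_prod_unfold)

lemma nrm_remainder_finite:
  assumes "t \<in> {S..T}"
  shows "nrm (remainder t) < \<top>"
proof -
  have [measurable]: "case_prod (Z t) \<in> borel_measurable (L \<Otimes>\<^sub>M P)" "case_prod (Z S) \<in> borel_measurable (L \<Otimes>\<^sub>M P)"
    using assms ST by (auto intro: measurable_Z)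
  have "case_prod (\<lambda>s \<omega>. Z t s \<omega> - Z S s \<omega>) \<in> borel_measurable (L \<Otimes>\<^sub>M P)"
    by measurable
  then show ?thesis
    using assms ST by (intro nrm_diff_finite measurable_Z finite_Z measurable_int_DZ nrm_int_DZ_finite) auto
qed

text \<open>The increment of the remainder is the difference of the error in the difference quotient of \<open>Z\<close> and
the error in the difference quotient of the pathwise integral, both multiplied by \<open>r - t\<close>. Minkowski's inequality
bounds the second one by the oscillation of \<open>DZ\<close> between \<open>t\<close> and \<open>r\<close>.\<close>

lemma nrm_remainder_increment_le:
  assumes t: "t \<in> {S..T}" and r: "r \<in> {S..T}" "r \<noteq> t"
    and c: "nrm (\<lambda>s \<omega>. (Z r s \<omega> - Z t s \<omega>) /\<^sub>R (r - t) - DZ t s \<omega>) \<le> ennreal c"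
    and d: "\<And>\<tau>. \<tau> \<in> {min t r..max t r} \<Longrightarrow> nrm (\<lambda>s \<omega>. DZ \<tau> s \<omega> - DZ t s \<omega>) \<le> ennreal c"
    and c0: "0 \<le> c"
  shows "nrm (\<lambda>s \<omega>. remainder r s \<omega> - remainder t s \<omega>) \<le> ennreal (2 * c * \<bar>r - t\<bar>)"
proof -
  let ?a = "\<lambda>s \<omega>. ennreal (norm ((Z r s \<omega> - Z t s \<omega>) /\<^sub>R (r - t) - DZ t s \<omega>))"
  let ?b = "\<lambda>s \<omega>. \<integral>\<^sup>+\<tau>. indicator {min t r..max t r} \<tau> * ennreal (norm (DZ \<tau> s \<omega> - DZ t s \<omega>)) \<partial>L"
  have [measurable]: "case_prod (Z t) \<in> borel_measurable (L \<Otimes>\<^sub>M P)" "case_prod (Z r) \<in> borel_measurable (L \<Otimes>\<^sub>M P)"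
      "case_prod (DZ t) \<in> borel_measurable (L \<Otimes>\<^sub>M P)"
    using t r by (auto intro: measurable_Z measurable_DZ_at)
  have [measurable]: "case_prod ?b \<in> borel_measurable (L \<Otimes>\<^sub>M P)"
    by (intro measurable_nn_integral_L measurable_indicator_fst measurable_norm_DZ_diff) measurable
  have ab: "case_prod (\<lambda>s \<omega>. ennreal \<bar>r - t\<bar> * ?a s \<omega> + ?b s \<omega>) \<in> borel_measurable (L \<Otimes>\<^sub>M P)"
    by measurable
  have Rdiff: "case_prod (\<lambda>s \<omega>. remainder r s \<omega> - remainder t s \<omega>) \<in> borel_measurable (L \<Otimes>\<^sub>M P)"
    using borel_measurable_diff[OF measurable_remainder[OF r(1)] measurable_remainder[OF t]] by (simp add: case_prod_unfold)
  have "AE (s, \<omega>) in L \<Otimes>\<^sub>M P. ennreal (norm (remainder r s \<omega> - remainder t s \<omega>)) \<le> ennreal \<bar>r - t\<bar> * ?a s \<omega> + ?b s \<omega>"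
    using AE_set_integrable_DZ
  proof (rule AE_mp, intro AE_I2 impI, clarify)
    fix s \<omega> assume int: "set_integrable lborel {S..T} (\<lambda>\<tau>. DZ \<tau> s \<omega>)"
    \<comment> \<open>The errors of the two difference quotients at \<open>t\<close>, multiplied by \<open>r - t\<close>.\<close>
    define x where "x = Z r s \<omega> - Z t s \<omega> - (r - t) *\<^sub>R DZ t s \<omega>"
    define y where "y = int_DZ r s \<omega> - int_DZ t s \<omega> - (r - t) *\<^sub>R DZ t s \<omega>"
    have "x = (r - t) *\<^sub>R ((Z r s \<omega> - Z t s \<omega>) /\<^sub>R (r - t) - DZ t s \<omega>)"
      using r by (simp add: x_def scaleR_diff_right)
    then have x: "ennreal (norm x) = ennreal \<bar>r - t\<bar> * ?a s \<omega>"
      by (simp add: ennreal_mult)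
    have y: "ennreal (norm y) \<le> ?b s \<omega>"
      unfolding y_def by (rule norm_increment_set_integral_le[OF int t r(1)])
    have "remainder r s \<omega> - remainder t s \<omega> = x - y" by (simp add: x_def y_def)
    then have "ennreal (norm (remainder r s \<omega> - remainder t s \<omega>)) \<le> ennreal (norm x) + ennreal (norm y)"
      by (simp add: ennreal_plus[symmetric] ennreal_leI norm_triangle_ineq4 del: ennreal_plus)
    also have "\<dots> \<le> ennreal \<bar>r - t\<bar> * ?a s \<omega> + ?b s \<omega>"
      using x y by (intro add_mono) auto
    finally show "ennreal (norm (remainder r s \<omega> - remainder t s \<omega>)) \<le> ennreal \<bar>r - t\<bar> * ?a s \<omega> + ?b s \<omega>" .
  qed
  then have "nrm (\<lambda>s \<omega>. remainder r s \<omega> - remainder t s \<omega>) \<le> mixed (\<lambda>s \<omega>. ennreal \<bar>r - t\<bar> * ?a s \<omega> + ?b s \<omega>)"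
    unfolding nrm_eq by (intro TP.mixed_Lp_mono_AE pq_pos measurable_norm_process Rdiff ab)
  also have "\<dots> \<le> mixed (\<lambda>s \<omega>. ennreal \<bar>r - t\<bar> * ?a s \<omega>) + mixed ?b"
    by (intro TP.mixed_Lp_triangle p q) measurable
  also have "mixed (\<lambda>s \<omega>. ennreal \<bar>r - t\<bar> * ?a s \<omega>) = ennreal \<bar>r - t\<bar> * mixed ?a"
    by (intro TP.mixed_Lp_cmult pq_pos) measurable
  also have "\<dots> \<le> ennreal \<bar>r - t\<bar> * ennreal c"
    using c by (intro mult_left_mono) (auto simp: nrm_eq)
  also have "mixed ?b \<le> ennreal c * ennreal (max t r - min t r)"
    using t r d by (intro mixed_integral_interval_le measurable_norm_DZ_diff) (auto simp: nrm_eq)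
  also have "ennreal \<bar>r - t\<bar> * ennreal c + ennreal c * ennreal (max t r - min t r) = ennreal (2 * c * \<bar>r - t\<bar>)"
  proof -
    have "max t r - min t r = \<bar>r - t\<bar>" by simp
    moreover have "2 * c * \<bar>r - t\<bar> = c * \<bar>r - t\<bar> + c * \<bar>r - t\<bar>" by simp
    ultimately show ?thesis
      using c0 by (simp only: ennreal_plus ennreal_mult abs_ge_zero mult_nonneg_nonneg mult.commute)
  qed
  finally show ?thesis by (simp add: add_mono)
qed

lemma nrm_remainder_has_derivative_0:
  assumes t: "t \<in> {S..T}"
  shows "((\<lambda>t. enn2real (nrm (remainder t))) has_field_derivative 0) (at t within {S..T})"
  unfolding has_field_derivative_iff
proof (rule tendstoI)
  fix e :: real assume e: "0 < e"
  have "\<forall>\<^sub>F r in at t within {S..T}. nrm (\<lambda>s \<omega>. DZ r s \<omega> - DZ t s \<omega>) < ennreal (e / 3)"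
    using continuous_DZ[OF t] e by (intro order_tendstoD) auto
  then obtain \<delta> where \<delta>: "0 < \<delta>"
      "\<And>r. r \<in> {S..T} \<Longrightarrow> r \<noteq> t \<Longrightarrow> dist r t < \<delta> \<Longrightarrow> nrm (\<lambda>s \<omega>. DZ r s \<omega> - DZ t s \<omega>) < ennreal (e / 3)"
    by (auto simp: eventually_at)
  have "\<forall>\<^sub>F r in at t within {S..T}. nrm (\<lambda>s \<omega>. (Z r s \<omega> - Z t s \<omega>) /\<^sub>R (r - t) - DZ t s \<omega>) < ennreal (e / 3)"
    using has_derivative_Z[OF t] e by (intro order_tendstoD) auto
  moreover have "\<forall>\<^sub>F r in at t within {S..T}. r \<noteq> t \<and> r \<in> {S..T} \<and> dist r t < \<delta>"
    using \<delta>(1) by (auto simp: eventually_at)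
  ultimately show "\<forall>\<^sub>F r in at t within {S..T}.
      dist ((enn2real (nrm (remainder r)) - enn2real (nrm (remainder t))) / (r - t)) 0 < e"
  proof eventually_elim
    case (elim r)
    then have r: "r \<in> {S..T}" "r \<noteq> t" "dist r t < \<delta>" by auto
    \<comment> \<open>The limit says nothing about \<open>\<tau> = t\<close>, where the norm is 0.\<close>
    have D: "nrm (\<lambda>s \<omega>. DZ \<tau> s \<omega> - DZ t s \<omega>) \<le> ennreal (e / 3)" if "\<tau> \<in> {min t r..max t r}" for \<tau>
    proof (cases "\<tau> = t")
      case True
      have "nrm (\<lambda>s \<omega>. DZ \<tau> s \<omega> - DZ t s \<omega>) = 0"
        unfolding nrm_eq True using measurable_DZ_at[OF t] by (subst TP.mixed_Lp_eq_0_iff) auto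
      then show ?thesis by simp
    next
      case False
      then show ?thesis
        using that r t by (intro less_imp_le \<delta>(2)) (auto simp: dist_real_def min_def max_def split: if_splits)
    qed
    have inc: "nrm (\<lambda>s \<omega>. remainder r s \<omega> - remainder t s \<omega>) \<le> ennreal (2 * (e / 3) * \<bar>r - t\<bar>)"
      using t r elim e D by (intro nrm_remainder_increment_le) auto
    have fin: "nrm (remainder r) < \<top>" "nrm (remainder t) < \<top>" using r t nrm_remainder_finite by auto
    have "enn2real (nrm (remainder r)) \<le> enn2real (nrm (remainder t) + ennreal (2 * (e / 3) * \<bar>r - t\<bar>))"
    proof (rule enn2real_mono)
      show "nrm (remainder r) \<le> nrm (remainder t) + ennreal (2 * (e / 3) * \<bar>r - t\<bar>)"
        using nrm_triangle[OF measurable_remainder[OF r(1)] measurable_remainder[OF t]] inc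
        by (elim order_trans) (rule add_left_mono)
    qed (use fin in auto)
    moreover have "enn2real (nrm (remainder t)) \<le> enn2real (nrm (remainder r) + ennreal (2 * (e / 3) * \<bar>r - t\<bar>))"
    proof (rule enn2real_mono)
      show "nrm (remainder t) \<le> nrm (remainder r) + ennreal (2 * (e / 3) * \<bar>r - t\<bar>)"
        using nrm_triangle[OF measurable_remainder[OF t] measurable_remainder[OF r(1)]] inc
        unfolding nrm_minus_commute[of "remainder t" "remainder r"]
        by (elim order_trans) (rule add_left_mono)
    qed (use fin in auto)
    moreover have "enn2real (x + ennreal (2 * (e / 3) * \<bar>r - t\<bar>)) = enn2real x + 2 * (e / 3) * \<bar>r - t\<bar>"
      if "x < \<top>" for x
      using that e by (subst enn2real_plus) auto
    ultimately have "\<bar>enn2real (nrm (remainder r)) - enn2real (nrm (remainder t))\<bar> \<le> 2 * (e / 3) * \<bar>r - t\<bar>"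
      using fin unfolding abs_le_iff by simp
    also have "\<dots> < e * \<bar>r - t\<bar>"
      using e r by (intro mult_strict_right_mono) auto
    finally show ?case
      using r by (simp add: abs_divide divide_less_eq)
  qed
qed

text \<open>The norm of the remainder has derivative 0 on \<open>[S,T]\<close> and vanishes at \<open>S\<close>.\<close>

lemma AE_Z_eq_integral:
  assumes t: "t \<in> {S..T}"
  shows "AE (s, \<omega>) in L \<Otimes>\<^sub>M P. Z t s \<omega> = Z S s \<omega> + int_DZ t s \<omega>"
proof -
  have "\<exists>c. \<forall>t\<in>{S..T}. enn2real (nrm (remainder t)) = c"
    by (rule has_field_derivative_zero_constant) (use nrm_remainder_has_derivative_0 in auto)
  then have "enn2real (nrm (remainder t)) = enn2real (nrm (remainder S))"
    using t ST by force
  also have "nrm (remainder S) = 0"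
  proof -
    have "int_DZ S s \<omega> = 0" for s \<omega>
      unfolding set_lebesgue_integral_def
      by (rule integral_eq_zero_AE, rule eventually_mono[OF AE_lborel_singleton[of S]]) simp
    then show ?thesis
      unfolding nrm_eq by (subst TP.mixed_Lp_eq_0_iff) auto
  qed
  finally have "nrm (remainder t) = 0"
    using nrm_remainder_finite[OF t] by (auto simp: enn2real_eq_0_iff)
  then have "AE (s, \<omega>) in L \<Otimes>\<^sub>M P. ennreal (norm (remainder t s \<omega>)) = 0"
    unfolding nrm_eq using measurable_remainder[OF t]
    by (subst (asm) TP.mixed_Lp_eq_0_iff) (auto simp: case_prod_unfold)
  then show ?thesis
    by (auto elim!: eventually_mono simp: algebra_simps)
qed

section \<open>The diagonal process\<close>

abbreviation DiagZ where "DiagZ \<equiv> Diag S T Z DZ"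

text \<open>Stated for an arbitrary \<open>\<sigma>\<close>-field \<open>Q\<close> on pairs \<open>(s,\<omega>)\<close>, because it is needed twice: for the product
\<open>\<sigma>\<close>-field, where the norms are computed, and for the progressive one.\<close>

lemma measurable_Diag_generic:
  assumes DZ: "(\<lambda>(\<tau>, s, \<omega>). DZ \<tau> s \<omega>) \<in> borel_measurable (leb_on S T \<Otimes>\<^sub>M Q)"
    and ZS [measurable]: "case_prod (Z S) \<in> borel_measurable Q"
    and fst [measurable]: "fst \<in> borel_measurable Q" and le: "\<And>z. z \<in> space Q \<Longrightarrow> fst z \<le> T"
  shows "case_prod DiagZ \<in> borel_measurable Q"
proof -
  have DZ': "(\<lambda>(\<tau>, z). DZ \<tau> (fst z) (snd z)) \<in> borel_measurable (leb_on S T \<Otimes>\<^sub>M Q)"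
    using DZ by (simp add: case_prod_unfold)
  note measurable_pair_swap[OF DZ', simplified case_prod_unfold, simplified, measurable]
  have [measurable]: "(\<lambda>z. \<integral>\<^sup>+\<tau>. ennreal (norm (DZ \<tau> (fst z) (snd z))) \<partial>L) \<in> borel_measurable Q"
    by (rule time.borel_measurable_nn_integral) (simp add: case_prod_unfold)
  have m_int: "(\<lambda>z. LINT \<tau>:{S..fst z}|lborel. DZ \<tau> (fst z) (snd z)) \<in> borel_measurable Q"
    by (rule measurable_partial_integral[OF DZ' fst le])
  have ZS': "(\<lambda>z. Z S (fst z) (snd z)) \<in> borel_measurable Q"
    using ZS by (simp add: case_prod_unfold)
  have "(\<lambda>z. if (\<integral>\<^sup>+\<tau>. ennreal (norm (DZ \<tau> (fst z) (snd z))) \<partial>L) < \<top>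
      then Z S (fst z) (snd z) + (LINT \<tau>:{S..fst z}|lborel. DZ \<tau> (fst z) (snd z)) else 0) \<in> borel_measurable Q"
  proof (intro measurable_If borel_measurable_add m_int ZS')
    show "{z \<in> space Q. (\<integral>\<^sup>+\<tau>. ennreal (norm (DZ \<tau> (fst z) (snd z))) \<partial>L) < \<top>} \<in> sets Q"
      by measurable
  qed simp
  also have "?this \<longleftrightarrow> ?thesis"
  proof (rule measurable_cong)
    fix z assume "z \<in> space Q"
    then have "(\<lambda>\<tau>. DZ \<tau> (fst z) (snd z)) \<in> borel_measurable L"
      using measurable_compose[OF measurable_Pair2' DZ', of z] by simp
    then have "set_integrable lborel {S..T} (\<lambda>\<tau>. DZ \<tau> (fst z) (snd z))
        \<longleftrightarrow> (\<integral>\<^sup>+\<tau>. ennreal (norm (DZ \<tau> (fst z) (snd z))) \<partial>L) < \<top>"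
      by (simp add: set_integrable_iff_leb_on integrable_iff_bounded)
    then show "(if (\<integral>\<^sup>+\<tau>. ennreal (norm (DZ \<tau> (fst z) (snd z))) \<partial>L) < \<top>
        then Z S (fst z) (snd z) + (LINT \<tau>:{S..fst z}|lborel. DZ \<tau> (fst z) (snd z)) else 0) = case_prod DiagZ z"
      by (simp add: Diag_def case_prod_unfold)
  qed
  finally show ?thesis .
qed

lemma measurable_Diag: "case_prod DiagZ \<in> borel_measurable (L \<Otimes>\<^sub>M P)"
proof (rule measurable_Diag_generic)
  show "case_prod (Z S) \<in> borel_measurable (L \<Otimes>\<^sub>M P)" using ST by (intro measurable_Z) auto
  show "fst \<in> borel_measurable (L \<Otimes>\<^sub>M P)"
    by (rule measurable_compose[OF measurable_fst measurable_leb_on_id])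
qed (use measurable_DZ in \<open>auto simp: space_pair_measure\<close>)

text \<open>Both branches of the definition are dominated pointwise by \<open>\<bar>Z(S,s)\<bar> + \<integral> \<bar>\<partial>\<^sub>tZ(\<tau>,s)\<bar> d\<tau>\<close>, and
Minkowski's inequality over \<open>[S,T]\<close> bounds the second summand.\<close>

lemma nrm_Diag_le: "nrm DiagZ \<le> nrm (Z S) + ennreal (T - S) * (SUP t\<in>{S..T}. nrm (DZ t))"
proof -
  let ?G = "\<lambda>s \<omega>. \<integral>\<^sup>+\<tau>. indicator {S..T} \<tau> * ennreal (norm (DZ \<tau> s \<omega>)) \<partial>L"
  have [measurable]: "case_prod (Z S) \<in> borel_measurable (L \<Otimes>\<^sub>M P)" "case_prod ?G \<in> borel_measurable (L \<Otimes>\<^sub>M P)"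
    using ST by (auto intro!: measurable_Z measurable_nn_integral_L measurable_indicator_fst measurable_norm_DZ)
  have "nrm DiagZ \<le> mixed (\<lambda>s \<omega>. ennreal (norm (Z S s \<omega>)) + ?G s \<omega>)"
    unfolding nrm_eq
  proof (intro TP.mixed_Lp_mono pq_pos)
    fix s \<omega> assume s: "s \<in> space L"
    have "ennreal (norm (DiagZ s \<omega>)) \<le> ennreal (norm (Z S s \<omega>) + norm (int_DZ s s \<omega>))"
      by (auto simp: Diag_def simp del: ennreal_plus intro!: ennreal_leI norm_triangle_ineq)
    also have "\<dots> \<le> ennreal (norm (Z S s \<omega>)) + (\<integral>\<^sup>+\<tau>. ennreal (norm (DZ \<tau> s \<omega>)) \<partial>L)"
      using s by (simp add: add_left_mono norm_set_integral_le_nn_integral)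
    also have "(\<integral>\<^sup>+\<tau>. ennreal (norm (DZ \<tau> s \<omega>)) \<partial>L) = ?G s \<omega>"
      by (intro nn_integral_cong) auto
    finally show "ennreal (norm (DiagZ s \<omega>)) \<le> ennreal (norm (Z S s \<omega>)) + ?G s \<omega>" .
  qed
  also have "\<dots> \<le> nrm (Z S) + mixed ?G"
    unfolding nrm_eq by (intro TP.mixed_Lp_triangle p q) measurable
  also have "mixed ?G \<le> (SUP t\<in>{S..T}. nrm (DZ t)) * ennreal (T - S)"
    using ST by (intro mixed_integral_interval_le measurable_norm_DZ)
      (auto simp: nrm_eq[symmetric] intro!: SUP_upper)
  finally show ?thesis by (simp add: mult.commute add_left_mono)
qed

lemma nrm_Diag_finite: "nrm DiagZ < \<top>"
proof -
  obtain K where K: "\<forall>t\<in>{S..T}. nrm (DZ t) \<le> ennreal K" using bounded_nrm_DZ by auto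
  have "nrm DiagZ \<le> nrm (Z S) + ennreal (T - S) * ennreal K"
    using nrm_Diag_le K by (elim order_trans) (auto intro!: add_left_mono mult_left_mono SUP_least)
  also have "\<dots> < \<top>" using finite_Z[of S] ST by (simp add: ennreal_mult_less_top)
  finally show ?thesis .
qed

lemma Lpq_norm_subinterval:
  assumes "S \<le> c" "d \<le> T"
  shows "Lpq_norm P p q c d \<phi> = mixed (\<lambda>s \<omega>. indicator {c..d} s * ennreal (norm (\<phi> s \<omega>)))"
  using assms pq_pos by (simp add: Lpq_norm_eq_mixed_Lp mixed_Lp_subinterval[of p q c d S T])

lemma mixed_indicator_tendsto_0:
  assumes f [measurable]: "case_prod f \<in> borel_measurable (L \<Otimes>\<^sub>M P)" and fin: "mixed f < \<top>" and t: "t \<in> {S..<T}"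
  shows "((\<lambda>\<epsilon>. mixed (\<lambda>s \<omega>. indicator {t..t + \<epsilon>} s * f s \<omega>)) \<longlongrightarrow> 0) (at_right 0)"
proof (rule tendsto_at_right_sequentially)
  show "0 < T - t" using t by simp
  fix X :: "nat \<Rightarrow> real" assume X: "\<And>n. 0 < X n" "\<And>n. X n < T - t" "X \<longlonglongrightarrow> 0"
  show "(\<lambda>n. mixed (\<lambda>s \<omega>. indicator {t..t + X n} s * f s \<omega>)) \<longlonglongrightarrow> 0"
  proof (intro TP.mixed_Lp_indicator_tendsto_0 f fin pq_pos)
    show "{t..t + X n} \<in> sets L" for n
      using Icc_in_sets_leb_on[of t "t + X n" S T] X(2)[of n] t by (simp add: Int_absorb2)
    have "\<forall>\<^sub>F n in sequentially. s \<notin> {t..t + X n}" if "s \<noteq> t" for s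
    proof (cases "t < s")
      case True
      then have "\<forall>\<^sub>F n in sequentially. X n < s - t" using X(3) by (intro order_tendstoD) auto
      then show ?thesis by eventually_elim auto
    qed (use that in auto)
    then show "AE s in L. \<forall>\<^sub>F n in sequentially. s \<notin> {t..t + X n}"
      using AE_lborel_singleton[of t] by (subst AE_restrict_space_iff) (auto elim!: eventually_mono)
  qed
qed

text \<open>On \<open>[t,t+\<epsilon>]\<close> the difference is the pathwise integral of \<open>DZ\<close> from \<open>t\<close> to \<open>s\<close>. After enlarging the range of
integration to \<open>[t,t+\<epsilon>]\<close>, which makes it independent of \<open>s\<close>, Minkowski's inequality applies to the
sum of \<open>DZ \<tau> - DZ t\<close> and \<open>DZ t\<close>, each of norm at most \<open>e / 2\<close> for small \<open>\<epsilon>\<close>.\<close>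

lemma nrm_Z_minus_Diag_small:
  assumes t: "t \<in> {S..<T}" and e: "0 < e"
  shows "\<forall>\<^sub>F \<epsilon> in at_right 0. Lpq_norm P p q t (t + \<epsilon>) (\<lambda>s \<omega>. Z t s \<omega> - DiagZ s \<omega>) \<le> ennreal (e * \<epsilon>)"
proof -
  have tT: "t \<in> {S..T}" using t by auto
  have [measurable]: "case_prod (Z t) \<in> borel_measurable (L \<Otimes>\<^sub>M P)" "case_prod (DZ t) \<in> borel_measurable (L \<Otimes>\<^sub>M P)"
    and [measurable]: "case_prod DiagZ \<in> borel_measurable (L \<Otimes>\<^sub>M P)"
    using tT by (auto intro: measurable_Z measurable_DZ_at measurable_Diag)
  let ?V = "\<lambda>\<epsilon> s \<omega>. indicator {t..t + \<epsilon>} s * ennreal (norm (DZ t s \<omega>))"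
  have "\<forall>\<^sub>F r in at t within {S..T}. nrm (\<lambda>s \<omega>. DZ r s \<omega> - DZ t s \<omega>) < ennreal (e / 2)"
    using continuous_DZ[OF tT] e by (intro order_tendstoD) auto
  then obtain \<delta> where \<delta>: "0 < \<delta>"
      "\<And>r. r \<in> {S..T} \<Longrightarrow> r \<noteq> t \<Longrightarrow> dist r t < \<delta> \<Longrightarrow> nrm (\<lambda>s \<omega>. DZ r s \<omega> - DZ t s \<omega>) < ennreal (e / 2)"
    by (auto simp: eventually_at)
  have "((\<lambda>\<epsilon>. mixed (?V \<epsilon>)) \<longlongrightarrow> 0) (at_right 0)"
    using finite_DZ[OF tT] t by (intro mixed_indicator_tendsto_0) (auto simp: nrm_eq)
  then have "\<forall>\<^sub>F \<epsilon> in at_right 0. mixed (?V \<epsilon>) < ennreal (e / 2)"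
    using e by (intro order_tendstoD) auto
  moreover have "\<forall>\<^sub>F \<epsilon> in at_right 0. \<epsilon> \<in> {0<..<min \<delta> (T - t)}"
    using \<delta>(1) t by (intro eventually_at_rightI[of 0 "min \<delta> (T - t)"]) auto
  ultimately show ?thesis
  proof eventually_elim
    case (elim \<epsilon>)
    then have \<epsilon>: "0 < \<epsilon>" "\<epsilon> < \<delta>" "t + \<epsilon> \<le> T" by auto
    let ?J = "{t..t + \<epsilon>}"
    let ?g = "\<lambda>\<tau> s \<omega>. ennreal (norm (DZ \<tau> s \<omega> - DZ t s \<omega>)) + ?V \<epsilon> s \<omega>"
    have J [measurable]: "?J \<in> sets L"
      using Icc_in_sets_leb_on[of t "t + \<epsilon>" S T] \<epsilon> t by (simp add: Int_absorb2)
    have V: "case_prod (?V \<epsilon>) \<in> borel_measurable (L \<Otimes>\<^sub>M P)"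
      by measurable
    have g: "(\<lambda>(\<tau>, s, \<omega>). ?g \<tau> s \<omega>) \<in> borel_measurable (L \<Otimes>\<^sub>M (L \<Otimes>\<^sub>M P))"
      using borel_measurable_add[OF measurable_norm_DZ_diff[of "DZ t"] measurable_compose[OF measurable_snd V]]
        measurable_DZ_at[OF tT] by (simp add: case_prod_unfold)
    have G: "case_prod (\<lambda>s \<omega>. \<integral>\<^sup>+\<tau>. indicator ?J \<tau> * ?g \<tau> s \<omega> \<partial>L) \<in> borel_measurable (L \<Otimes>\<^sub>M P)"
      by (intro measurable_nn_integral_L measurable_indicator_fst g)
    have "AE (s, \<omega>) in L \<Otimes>\<^sub>M P. indicator ?J s * ennreal (norm (Z t s \<omega> - DiagZ s \<omega>))
        \<le> (\<integral>\<^sup>+\<tau>. indicator ?J \<tau> * ?g \<tau> s \<omega> \<partial>L)"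
      using AE_set_integrable_DZ AE_Z_eq_integral[OF tT] AE_space
    proof (eventually_elim, clarify)
      fix s \<omega>
      assume int: "set_integrable lborel {S..T} (\<lambda>\<tau>. DZ \<tau> s \<omega>)" and eq: "Z t s \<omega> = Z S s \<omega> + int_DZ t s \<omega>"
        and sp: "(s, \<omega>) \<in> space (L \<Otimes>\<^sub>M P)"
      show "indicator ?J s * ennreal (norm (Z t s \<omega> - DiagZ s \<omega>)) \<le> (\<integral>\<^sup>+\<tau>. indicator ?J \<tau> * ?g \<tau> s \<omega> \<partial>L)"
      proof (cases "s \<in> ?J")
        case True
        have sT: "s \<in> {S..T}" using sp by (simp add: space_pair_measure)
        have "norm (Z t s \<omega> - DiagZ s \<omega>) = norm (int_DZ s s \<omega> - int_DZ t s \<omega> - (s - t) *\<^sub>R 0)"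
          using int by (simp add: Diag_def eq norm_minus_commute)
        then have "ennreal (norm (Z t s \<omega> - DiagZ s \<omega>))
            \<le> (\<integral>\<^sup>+\<tau>. indicator {min t s..max t s} \<tau> * ennreal (norm (DZ \<tau> s \<omega> - 0)) \<partial>L)"
          using norm_increment_set_integral_le[OF int tT sT, of 0] by simp
        also have "\<dots> \<le> (\<integral>\<^sup>+\<tau>. indicator ?J \<tau> * ?g \<tau> s \<omega> \<partial>L)"
        proof (rule nn_integral_mono)
          fix \<tau>
          have "norm (DZ \<tau> s \<omega>) \<le> norm (DZ \<tau> s \<omega> - DZ t s \<omega>) + norm (DZ t s \<omega>)"
            by (metis diff_add_cancel norm_triangle_ineq)
          then have "ennreal (norm (DZ \<tau> s \<omega>)) \<le> ?g \<tau> s \<omega>"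
            using True by (simp add: ennreal_plus[symmetric] ennreal_leI del: ennreal_plus)
          moreover have "indicator {min t s..max t s} \<tau> \<le> (indicator ?J \<tau> :: ennreal)"
            using True by (auto simp: indicator_def)
          ultimately show "indicator {min t s..max t s} \<tau> * ennreal (norm (DZ \<tau> s \<omega> - 0)) \<le> indicator ?J \<tau> * ?g \<tau> s \<omega>"
            by (simp add: mult_mono)
        qed
        finally show ?thesis using True by simp
      qed simp
    qed
    moreover have "case_prod (\<lambda>s \<omega>. indicator ?J s * ennreal (norm (Z t s \<omega> - DiagZ s \<omega>))) \<in> borel_measurable (L \<Otimes>\<^sub>M P)"
      by measurable
    ultimately have "Lpq_norm P p q t (t + \<epsilon>) (\<lambda>s \<omega>. Z t s \<omega> - DiagZ s \<omega>)
        \<le> mixed (\<lambda>s \<omega>. \<integral>\<^sup>+\<tau>. indicator ?J \<tau> * ?g \<tau> s \<omega> \<partial>L)"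
      using t \<epsilon> G by (subst Lpq_norm_subinterval) (auto intro!: TP.mixed_Lp_mono_AE pq_pos)
    also have "\<dots> \<le> ennreal e * ennreal (t + \<epsilon> - t)"
    proof (rule mixed_integral_interval_le[OF g])
      fix \<tau> assume \<tau>: "\<tau> \<in> ?J"
      then have \<tau>T: "\<tau> \<in> {S..T}" using t \<epsilon> by auto
      have [measurable]: "case_prod (DZ \<tau>) \<in> borel_measurable (L \<Otimes>\<^sub>M P)" using \<tau>T by (rule measurable_DZ_at)
      have "mixed (?g \<tau>) \<le> nrm (\<lambda>s \<omega>. DZ \<tau> s \<omega> - DZ t s \<omega>) + mixed (?V \<epsilon>)"
        unfolding nrm_eq by (intro TP.mixed_Lp_triangle p q V) measurable
      also have "nrm (\<lambda>s \<omega>. DZ \<tau> s \<omega> - DZ t s \<omega>) \<le> ennreal (e / 2)"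
      proof (cases "\<tau> = t")
        case True
        then have "nrm (\<lambda>s \<omega>. DZ \<tau> s \<omega> - DZ t s \<omega>) = 0"
          unfolding nrm_eq by (subst TP.mixed_Lp_eq_0_iff) auto
        then show ?thesis by simp
      next
        case False
        then show ?thesis
          using \<tau> \<epsilon> \<tau>T by (intro less_imp_le \<delta>(2)) (auto simp: dist_real_def)
      qed
      also have "mixed (?V \<epsilon>) \<le> ennreal (e / 2)" using elim by simp
      also have "ennreal (e / 2) + ennreal (e / 2) = ennreal e"
        using e by (simp add: ennreal_plus[symmetric] del: ennreal_plus)
      finally show "mixed (?g \<tau>) \<le> ennreal e" by (simp add: add_mono)
    qed (use t \<epsilon> in auto)
    also have "\<dots> = ennreal (e * \<epsilon>)" using e \<epsilon> by (simp add: ennreal_mult)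
    finally show ?case .
  qed
qed

end

section \<open>Lowering the exponents\<close>

lemma measurable_restrict_time:
  assumes "{c..d} \<subseteq> {a..b}" and f: "f \<in> borel_measurable (leb_on a b \<Otimes>\<^sub>M P)"
  shows "f \<in> borel_measurable (leb_on c d \<Otimes>\<^sub>M P)"
proof -
  have [measurable]: "(\<lambda>x. x) \<in> leb_on c d \<rightarrow>\<^sub>M leb_on a b"
    using assms(1) by (intro measurable_restrict_space2 measurable_restrict_space1) auto
  have "(\<lambda>z. (fst z, snd z)) \<in> leb_on c d \<Otimes>\<^sub>M P \<rightarrow>\<^sub>M leb_on a b \<Otimes>\<^sub>M P"
    by (intro measurable_Pair measurable_snd measurable_compose[OF measurable_fst]) fact
  from measurable_compose[OF this f] show ?thesis by simp
qed

lemma Lpq_norm_exponent_le: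
  assumes P: "prob_space P" and ab: "a < b" and m: "case_prod \<phi> \<in> borel_measurable (leb_on a b \<Otimes>\<^sub>M P)"
    and p: "1 \<le> p'" "p' \<le> p" and q: "1 \<le> q'" "q' \<le> q"
  shows "Lpq_norm P p' q' a b \<phi> \<le> ennreal ((b - a) powr (1 / q' - 1 / q)) * Lpq_norm P p q a b \<phi>"
proof -
  interpret P: prob_space P by fact
  interpret L: finite_measure "leb_on a b" by (rule finite_measure_leb_on)
  interpret pair_sigma_finite "leb_on a b" P ..
  have "case_prod (\<lambda>s \<omega>. ennreal (norm (\<phi> s \<omega>))) \<in> borel_measurable (leb_on a b \<Otimes>\<^sub>M P)"
    using measurable_compose[OF m, of "\<lambda>x. ennreal (norm x)" borel] by (simp add: case_prod_unfold)
  then show ?thesis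
    using mixed_Lp_exponent_le[OF _ L.finite_measure_axioms _ _ P p q] ab p q
    by (simp add: Lpq_norm_eq_mixed_Lp emeasure_leb_on_Icc)
qed

lemma C_Lpq_memD:
  assumes "Z \<in> C_Lpq P F p q S T"
  shows C_Lpq_measurable: "(\<lambda>(t, s, \<omega>). Z t s \<omega>) \<in> borel_measurable (restrict_space borel {S..T} \<Otimes>\<^sub>M progressive F S T)"
    and C_Lpq_in_Lpq: "\<And>t. t \<in> {S..T} \<Longrightarrow> Z t \<in> Lpq P F p q S T"
    and C_Lpq_tendsto: "\<And>t. t \<in> {S..T} \<Longrightarrow>
      ((\<lambda>r. Lpq_norm P p q S T (\<lambda>s \<omega>. Z r s \<omega> - Z t s \<omega>)) \<longlongrightarrow> 0) (at t within {S..T})"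
  using assms unfolding C_Lpq_def by blast+

lemma Lpq_memD:
  assumes "\<phi> \<in> Lpq P F p q S T"
  shows Lpq_measurable: "case_prod \<phi> \<in> borel_measurable (progressive F S T)"
    and Lpq_finite: "Lpq_norm P p q S T \<phi> < \<top>"
  using assms unfolding Lpq_def by auto

lemma Lpq_exponent_mono:
  assumes P: "prob_space P" and ST: "S < T"
    and m: "case_prod \<phi> \<in> borel_measurable (leb_on S T \<Otimes>\<^sub>M P)"
    and p: "1 \<le> p'" "p' \<le> p" and q: "1 \<le> q'" "q' \<le> q"
    and \<phi>: "\<phi> \<in> Lpq P F p q S T"
  shows "\<phi> \<in> Lpq P F p' q' S T"
proof -
  have "Lpq_norm P p' q' S T \<phi> \<le> ennreal ((T - S) powr (1 / q' - 1 / q)) * Lpq_norm P p q S T \<phi>"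
    by (rule Lpq_norm_exponent_le[OF P ST m p q])
  also have "\<dots> < \<top>"
    using Lpq_finite[OF \<phi>] by (simp add: ennreal_mult_less_top)
  finally show ?thesis
    using Lpq_measurable[OF \<phi>] unfolding Lpq_def by simp
qed

lemma C_Lpq_exponent_mono:
  assumes P: "prob_space P" and ST: "S < T"
    and m: "\<And>t. t \<in> {S..T} \<Longrightarrow> case_prod (Z t) \<in> borel_measurable (leb_on S T \<Otimes>\<^sub>M P)"
    and p: "1 \<le> p'" "p' \<le> p" and q: "1 \<le> q'" "q' \<le> q"
    and Z: "Z \<in> C_Lpq P F p q S T"
  shows "Z \<in> C_Lpq P F p' q' S T"
proof -
  have "((\<lambda>r. Lpq_norm P p' q' S T (\<lambda>s \<omega>. Z r s \<omega> - Z t s \<omega>)) \<longlongrightarrow> 0) (at t within {S..T})"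
    if t: "t \<in> {S..T}" for t
  proof (rule tendsto_sandwich[OF _ _ tendsto_const])
    let ?c = "ennreal ((T - S) powr (1 / q' - 1 / q))"
    have "((\<lambda>r. ?c * Lpq_norm P p q S T (\<lambda>s \<omega>. Z r s \<omega> - Z t s \<omega>)) \<longlongrightarrow> ?c * 0) (at t within {S..T})"
      by (intro ennreal_tendsto_cmult C_Lpq_tendsto[OF Z t]) simp
    then show "((\<lambda>r. ?c * Lpq_norm P p q S T (\<lambda>s \<omega>. Z r s \<omega> - Z t s \<omega>)) \<longlongrightarrow> 0) (at t within {S..T})"
      by simp
    show "\<forall>\<^sub>F r in at t within {S..T}. Lpq_norm P p' q' S T (\<lambda>s \<omega>. Z r s \<omega> - Z t s \<omega>)
        \<le> ?c * Lpq_norm P p q S T (\<lambda>s \<omega>. Z r s \<omega> - Z t s \<omega>)"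
      unfolding eventually_at_filter
    proof (intro always_eventually allI impI)
      fix r assume "r \<in> {S..T}"
      note [measurable] = m[OF this] m[OF t]
      show "Lpq_norm P p' q' S T (\<lambda>s \<omega>. Z r s \<omega> - Z t s \<omega>) \<le> ?c * Lpq_norm P p q S T (\<lambda>s \<omega>. Z r s \<omega> - Z t s \<omega>)"
        by (intro Lpq_norm_exponent_le P ST p q) measurable
    qed
  qed auto
  moreover have "Z t \<in> Lpq P F p' q' S T" if "t \<in> {S..T}" for t
    by (rule Lpq_exponent_mono[OF P ST m[OF that] p q C_Lpq_in_Lpq[OF Z that]])
  ultimately show ?thesis
    using C_Lpq_measurable[OF Z] unfolding C_Lpq_def by blast
qed

context C1_process
begin

lemma Lpq_norm_Z_minus_Diag_le:
  assumes t: "t \<in> {S..<T}" and \<epsilon>: "\<epsilon> \<in> {0<..T - t}"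
    and p': "1 \<le> p'" "p' \<le> p" and q': "1 \<le> q'" "q' \<le> q"
  shows "Lpq_norm P p' q' t (t + \<epsilon>) (\<lambda>s \<omega>. Z t s \<omega> - DiagZ s \<omega>)
    \<le> ennreal (\<epsilon> powr (1 / q' - 1 / q)) * Lpq_norm P p q t (t + \<epsilon>) (\<lambda>s \<omega>. Z t s \<omega> - DiagZ s \<omega>)"
proof -
  have [measurable]: "case_prod (Z t) \<in> borel_measurable (L \<Otimes>\<^sub>M P)" "case_prod DiagZ \<in> borel_measurable (L \<Otimes>\<^sub>M P)"
    using t by (auto intro: measurable_Z measurable_Diag)
  have "case_prod (\<lambda>s \<omega>. Z t s \<omega> - DiagZ s \<omega>) \<in> borel_measurable (L \<Otimes>\<^sub>M P)"
    by measurable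
  then have "case_prod (\<lambda>s \<omega>. Z t s \<omega> - DiagZ s \<omega>) \<in> borel_measurable (leb_on t (t + \<epsilon>) \<Otimes>\<^sub>M P)"
    by (rule measurable_restrict_time[rotated]) (use t \<epsilon> in auto)
  from Lpq_norm_exponent_le[OF prob_space_axioms _ this p' q'] \<epsilon> show ?thesis by simp
qed

lemma Lpq_norm_Z_minus_Diag_finite:
  assumes t: "t \<in> {S..<T}" and \<epsilon>: "\<epsilon> \<in> {0<..T - t}"
    and p': "1 \<le> p'" "p' \<le> p" and q': "1 \<le> q'" "q' \<le> q"
  shows "Lpq_norm P p' q' t (t + \<epsilon>) (\<lambda>s \<omega>. Z t s \<omega> - DiagZ s \<omega>) < \<top>"
proof -
  have "Lpq_norm P p q t (t + \<epsilon>) (\<lambda>s \<omega>. Z t s \<omega> - DiagZ s \<omega>) \<le> nrm (\<lambda>s \<omega>. Z t s \<omega> - DiagZ s \<omega>)"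
    using t \<epsilon> by (subst Lpq_norm_subinterval)
      (auto simp: nrm_eq indicator_def intro!: TP.mixed_Lp_mono pq_pos)
  also have "\<dots> < \<top>"
    using t by (intro nrm_diff_finite measurable_Z measurable_Diag finite_Z nrm_Diag_finite) auto
  finally show ?thesis
    using Lpq_norm_Z_minus_Diag_le[OF assms] by (auto simp: ennreal_mult_less_top elim!: le_less_trans)
qed

lemma Lpq_norm_Z_minus_Diag_small:
  assumes t: "t \<in> {S..<T}" and e: "0 < e"
    and p': "1 \<le> p'" "p' \<le> p" and q': "1 \<le> q'" "q' \<le> q"
  shows "\<forall>\<^sub>F \<epsilon> in at_right 0. Lpq_norm P p' q' t (t + \<epsilon>) (\<lambda>s \<omega>. Z t s \<omega> - DiagZ s \<omega>)
    \<le> ennreal (e * \<epsilon> powr (1 + 1 / q' - 1 / q))"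
proof -
  have "\<forall>\<^sub>F \<epsilon> in at_right 0. \<epsilon> \<in> {0<..<T - t}"
    using t by (intro eventually_at_rightI[of 0 "T - t"]) auto
  with nrm_Z_minus_Diag_small[OF t e] show ?thesis
  proof eventually_elim
    case (elim \<epsilon>)
    then have "Lpq_norm P p' q' t (t + \<epsilon>) (\<lambda>s \<omega>. Z t s \<omega> - DiagZ s \<omega>)
        \<le> ennreal (\<epsilon> powr (1 / q' - 1 / q)) * ennreal (e * \<epsilon>)"
      by (intro order_trans[OF Lpq_norm_Z_minus_Diag_le[OF t _ p' q'] mult_left_mono]) auto
    also have "\<dots> = ennreal (e * (\<epsilon> powr 1 * \<epsilon> powr (1 / q' - 1 / q)))"
      using elim e by (simp add: ennreal_mult[symmetric] mult_ac)
    also have "\<epsilon> powr 1 * \<epsilon> powr (1 / q' - 1 / q) = \<epsilon> powr (1 + 1 / q' - 1 / q)"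
      by (simp only: powr_add[symmetric] add_diff_eq)
    finally show ?case .
  qed
qed

lemma Z_minus_Diag_smallo:
  assumes t: "t \<in> {S..<T}" and p': "1 \<le> p'" "p' \<le> p" and q': "1 \<le> q'" "q' \<le> q"
  shows "(\<lambda>\<epsilon>. enn2real (Lpq_norm P p' q' t (t + \<epsilon>) (\<lambda>s \<omega>. Z t s \<omega> - DiagZ s \<omega>)))
    \<in> o[at_right 0](\<lambda>\<epsilon>. \<epsilon> powr (1 + 1 / q' - 1 / q))"
proof (rule landau_o.smallI)
  fix e :: real assume e: "0 < e"
  show "\<forall>\<^sub>F \<epsilon> in at_right 0. norm (enn2real (Lpq_norm P p' q' t (t + \<epsilon>) (\<lambda>s \<omega>. Z t s \<omega> - DiagZ s \<omega>)))
      \<le> e * norm (\<epsilon> powr (1 + 1 / q' - 1 / q))"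
    using Lpq_norm_Z_minus_Diag_small[OF t e p' q']
    by eventually_elim (use e in \<open>auto intro: enn2real_leI\<close>)
qed

text \<open>For \<open>p' = q' = 1\<close> the exponent of \<open>\<epsilon>\<close> is \<open>2 - 1/q\<close>, which is at least 1 because \<open>q \<ge> 1\<close>.\<close>

lemma average_Z_minus_Diag_tendsto_0:
  assumes t: "t \<in> {S..<T}"
  shows "((\<lambda>\<epsilon>. ennreal (1 / \<epsilon>) * Lpq_norm P 1 1 t (t + \<epsilon>) (\<lambda>s \<omega>. Z t s \<omega> - DiagZ s \<omega>)) \<longlongrightarrow> 0) (at_right 0)"
proof (rule tendsto_0_ennrealI)
  fix e :: real assume e: "0 < e"
  have "\<forall>\<^sub>F \<epsilon> in at_right 0. \<epsilon> \<in> {0<..<1::real}"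
    by (intro eventually_at_rightI[of 0 1]) auto
  with Lpq_norm_Z_minus_Diag_small[OF t e order_refl p order_refl q]
  show "\<forall>\<^sub>F \<epsilon> in at_right 0. ennreal (1 / \<epsilon>) * Lpq_norm P 1 1 t (t + \<epsilon>) (\<lambda>s \<omega>. Z t s \<omega> - DiagZ s \<omega>) \<le> ennreal e"
  proof eventually_elim
    case (elim \<epsilon>)
    have "\<epsilon> powr (1 + 1 / 1 - 1 / q) \<le> \<epsilon> powr 1"
      using elim q by (intro powr_mono') auto
    then have "e * \<epsilon> powr (1 + 1 / 1 - 1 / q) \<le> e * \<epsilon>"
      using e elim by (intro mult_left_mono) auto
    then have "Lpq_norm P 1 1 t (t + \<epsilon>) (\<lambda>s \<omega>. Z t s \<omega> - DiagZ s \<omega>) \<le> ennreal (e * \<epsilon>)"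
      using elim by (elim conjE order_trans) (auto intro: ennreal_leI)
    then have "ennreal (1 / \<epsilon>) * Lpq_norm P 1 1 t (t + \<epsilon>) (\<lambda>s \<omega>. Z t s \<omega> - DiagZ s \<omega>)
        \<le> ennreal (1 / \<epsilon>) * ennreal (e * \<epsilon>)"
      by (intro mult_left_mono) auto
    also have "\<dots> = ennreal e" using elim e by (simp add: ennreal_mult[symmetric])
    finally show ?case .
  qed
qed

end

section \<open>Uniqueness\<close>

text \<open>Let \<open>\<nu>\<close> be the measure with density \<open>g\<close> and let \<open>e > 0\<close>. The supremum \<open>c\<close> of all \<open>u\<close> with
\<open>\<nu>[S,u] \<le> e (u - S)\<close> is attained, by continuity of \<open>\<nu>\<close> from below and because \<open>\<nu>\<close> has no atoms. If \<open>c < T\<close>, the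
hypothesis at \<open>c\<close> extends the inequality beyond \<open>c\<close>. Therefore \<open>\<nu>[S,T] \<le> e (T - S)\<close> for all \<open>e\<close>.\<close>

lemma nn_integral_eq_0_if_right_derivative_0:
  fixes g :: "real \<Rightarrow> ennreal"
  assumes [measurable]: "g \<in> borel_measurable (leb_on S T)" and "S < T"
    and lim: "\<And>t. t \<in> {S..<T} \<Longrightarrow>
      ((\<lambda>\<epsilon>. ennreal (1 / \<epsilon>) * (\<integral>\<^sup>+s. indicator {t..t + \<epsilon>} s * g s \<partial>leb_on S T)) \<longlongrightarrow> 0) (at_right 0)"
  shows "(\<integral>\<^sup>+s. g s \<partial>leb_on S T) = 0"
proof -
  define \<nu> where "\<nu> = density (leb_on S T) g"
  have sets_\<nu>: "sets \<nu> = sets (leb_on S T)" by (simp add: \<nu>_def)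
  have Icc: "{a..b} \<in> sets \<nu>" if "S \<le> a" "b \<le> T" for a b
    using Icc_in_sets_leb_on[of a b S T] that by (simp add: sets_\<nu> Int_absorb2)
  have em: "emeasure \<nu> {a..b} = (\<integral>\<^sup>+s. indicator {a..b} s * g s \<partial>leb_on S T)" if "S \<le> a" "b \<le> T" for a b
    using Icc[OF that] by (simp add: sets_\<nu>) (simp add: \<nu>_def emeasure_density mult.commute)
  have point: "emeasure \<nu> {c} = 0" if "c \<in> {S..T}" for c
  proof -
    have "AE s in leb_on S T. s \<noteq> c"
      using AE_lborel_singleton[of c] by (subst AE_restrict_space_iff) (auto elim!: eventually_mono)
    then have "AE s in leb_on S T. indicator {c..c} s * g s = 0"
      by eventually_elim auto
    then have "(\<integral>\<^sup>+s. indicator {c..c} s * g s \<partial>leb_on S T) = 0"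
      by (subst nn_integral_0_iff_AE) (use Icc[of c c] that in \<open>auto simp: sets_\<nu>\<close>)
    then show ?thesis using em[of c c] that by simp
  qed
  have small: "emeasure \<nu> {S..T} \<le> ennreal (e * (T - S))" if e: "0 < e" for e
  proof -
    define A where "A = {u \<in> {S..T}. emeasure \<nu> {S..u} \<le> ennreal (e * (u - S))}"
    have SA: "S \<in> A" using point[of S] \<open>S < T\<close> by (simp add: A_def)
    have bdd: "bdd_above A" by (rule bdd_aboveI[of _ T]) (auto simp: A_def)
    define c where "c = Sup A"
    have c: "S \<le> c" "c \<le> T"
      unfolding c_def by (rule cSup_upper[OF SA bdd], rule cSup_least) (use SA in \<open>auto simp: A_def\<close>)
    have below: "emeasure \<nu> {S..u} \<le> ennreal (e * (c - S))" if "u < c" for u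
    proof -
      obtain a where a: "a \<in> A" "u < a"
        using \<open>u < c\<close> less_cSup_iff[OF _ bdd, of u] SA unfolding c_def by blast
      then have "emeasure \<nu> {S..u} \<le> emeasure \<nu> {S..a}"
        by (intro emeasure_mono Icc) (auto simp: A_def)
      also have "\<dots> \<le> ennreal (e * (a - S))" using a by (simp add: A_def)
      also have "\<dots> \<le> ennreal (e * (c - S))"
        using e cSup_upper[OF a(1) bdd] by (intro ennreal_leI) (simp add: c_def)
      finally show ?thesis .
    qed
    have cA: "emeasure \<nu> {S..c} \<le> ennreal (e * (c - S))"
    proof -
      let ?B = "\<lambda>n::nat. {S..c - inverse (real (Suc n))}"
      have B: "range ?B \<subseteq> sets \<nu>"
      proof (intro image_subsetI Icc order_refl)
        fix n
        have "0 \<le> inverse (real (Suc n))" by simp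
        then show "c - inverse (real (Suc n)) \<le> T" using c by linarith
      qed
      then have U: "(\<Union>n. ?B n) \<in> sets \<nu>" by (rule sets.countable_UN)
      have point_set: "{c} \<in> sets \<nu>" using Icc[of c c] c by simp
      \<comment> \<open>Continuity from below reaches the half-open interval; the missing point \<open>c\<close> has measure 0.\<close>
      have "{S..c} \<subseteq> (\<Union>n. ?B n) \<union> {c}"
      proof
        fix x assume x: "x \<in> {S..c}"
        show "x \<in> (\<Union>n. ?B n) \<union> {c}"
        proof (cases "x = c")
          case False
          then obtain n where "inverse (real (Suc n)) < c - x"
            using reals_Archimedean[of "c - x"] x by auto
          then show ?thesis using x by (intro UnI1 UN_I[of n]) auto
        qed simp
      qed
      then have "emeasure \<nu> {S..c} \<le> emeasure \<nu> ((\<Union>n. ?B n) \<union> {c})"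
        by (intro emeasure_mono sets.Un U point_set)
      also have "\<dots> \<le> emeasure \<nu> (\<Union>n. ?B n) + emeasure \<nu> {c}"
        by (intro emeasure_subadditive U point_set)
      also have "\<dots> = (SUP n. emeasure \<nu> (?B n))"
      proof -
        have "incseq ?B"
        proof (rule incseq_SucI)
          fix n
          have "inverse (real (Suc (Suc n))) \<le> inverse (real (Suc n))"
            by (intro le_imp_inverse_le) auto
          then show "?B n \<le> ?B (Suc n)" by (subst atLeastatMost_subset_iff) linarith
        qed
        from SUP_emeasure_incseq[OF B this] show ?thesis
          using point[of c] c by simp
      qed
      also have "\<dots> \<le> ennreal (e * (c - S))"
        by (intro SUP_least below) simp
      finally show ?thesis .
    qed
    have "c = T"
    proof (rule ccontr)
      assume "c \<noteq> T"
      with c have cT: "c \<in> {S..<T}" by auto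
      have "\<forall>\<^sub>F \<epsilon> in at_right 0. ennreal (1 / \<epsilon>) * (\<integral>\<^sup>+s. indicator {c..c + \<epsilon>} s * g s \<partial>leb_on S T) < ennreal e"
        using lim[OF cT] e by (intro order_tendstoD) auto
      moreover have "\<forall>\<^sub>F \<epsilon> in at_right 0. \<epsilon> \<in> {0<..<T - c}"
        using cT by (intro eventually_at_rightI[of 0 "T - c"]) auto
      ultimately have "\<forall>\<^sub>F \<epsilon> in at_right 0.
          ennreal (1 / \<epsilon>) * (\<integral>\<^sup>+s. indicator {c..c + \<epsilon>} s * g s \<partial>leb_on S T) < ennreal e \<and> \<epsilon> \<in> {0<..<T - c}"
        by (rule eventually_conj)
      from eventually_happens'[OF trivial_limit_at_right_real this]
      obtain \<epsilon> where \<epsilon>: "\<epsilon> \<in> {0<..<T - c}"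
          and less: "ennreal (1 / \<epsilon>) * (\<integral>\<^sup>+s. indicator {c..c + \<epsilon>} s * g s \<partial>leb_on S T) < ennreal e"
        by blast
      from \<epsilon> have \<epsilon>: "0 < \<epsilon>" "\<epsilon> < T - c" by auto
      have "emeasure \<nu> {c..c + \<epsilon>} = ennreal \<epsilon> * (ennreal (1 / \<epsilon>) * emeasure \<nu> {c..c + \<epsilon>})"
        using \<epsilon> by (simp add: mult.assoc[symmetric] ennreal_mult[symmetric])
      also have "\<dots> \<le> ennreal \<epsilon> * ennreal e"
        using less \<epsilon> c by (intro mult_left_mono) (auto simp: em)
      finally have inc: "emeasure \<nu> {c..c + \<epsilon>} \<le> ennreal (e * \<epsilon>)"
        using \<epsilon> e by (simp add: ennreal_mult[symmetric] mult.commute)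
      have "{S..c} \<union> {c..c + \<epsilon>} = {S..c + \<epsilon>}" using c \<epsilon> by auto
      moreover have "emeasure \<nu> ({S..c} \<union> {c..c + \<epsilon>}) \<le> emeasure \<nu> {S..c} + emeasure \<nu> {c..c + \<epsilon>}"
        using c \<epsilon> by (intro emeasure_subadditive Icc) auto
      ultimately have "emeasure \<nu> {S..c + \<epsilon>} \<le> emeasure \<nu> {S..c} + emeasure \<nu> {c..c + \<epsilon>}"
        by (simp only:)
      also have "\<dots> \<le> ennreal (e * (c - S)) + ennreal (e * \<epsilon>)" using cA inc by (rule add_mono)
      also have "\<dots> = ennreal (e * (c + \<epsilon> - S))"
        using c \<epsilon> e by (simp add: ennreal_plus[symmetric] algebra_simps del: ennreal_plus)
      finally have "c + \<epsilon> \<in> A" using c \<epsilon> by (simp add: A_def)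
      then have "c + \<epsilon> \<le> c" unfolding c_def by (intro cSup_upper bdd)
      then show False using \<epsilon> by simp
    qed
    then show ?thesis using cA by simp
  qed
  have "emeasure \<nu> {S..T} \<le> 0"
  proof (rule ennreal_le_epsilon)
    fix e :: real assume "0 < e"
    then show "emeasure \<nu> {S..T} \<le> 0 + ennreal e"
      using small[of "e / (T - S)"] \<open>S < T\<close> by simp
  qed
  moreover have "(\<integral>\<^sup>+s. g s \<partial>leb_on S T) = emeasure \<nu> {S..T}"
    by (simp add: em) (intro nn_integral_cong, simp)
  ultimately show ?thesis by simp
qed

lemma Lpq_norm_1_1:
  "Lpq_norm P 1 1 a b \<phi> = (\<integral>\<^sup>+\<omega>. (\<integral>\<^sup>+s\<in>{a..b}. ennreal (norm (\<phi> s \<omega>)) \<partial>lborel) \<partial>P)"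
  by (simp add: Lpq_norm_def)

text \<open>The uniqueness part of Property (D): the triangle inequality through \<open>Z t\<close> shows that
the integral of \<open>s \<mapsto> E \<bar>\<phi> s - \<psi> s\<bar>\<close> over \<open>[t,t+\<epsilon>]\<close> is \<open>o(\<epsilon>)\<close> for every \<open>t\<close>.\<close>

lemma average_difference_determines_process:
  fixes \<phi> \<psi> :: "real \<Rightarrow> 'w \<Rightarrow> 'h::euclidean_space"
  assumes P: "prob_space P" and ST: "S < T"
    and m: "case_prod \<phi> \<in> borel_measurable (leb_on S T \<Otimes>\<^sub>M P)" "case_prod \<psi> \<in> borel_measurable (leb_on S T \<Otimes>\<^sub>M P)"
    and mZ: "\<And>t. t \<in> {S..T} \<Longrightarrow> case_prod (Z t) \<in> borel_measurable (leb_on S T \<Otimes>\<^sub>M P)"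
    and lim: "\<And>t. t \<in> {S..<T} \<Longrightarrow>
      ((\<lambda>\<epsilon>. ennreal (1 / \<epsilon>) * Lpq_norm P 1 1 t (t + \<epsilon>) (\<lambda>s \<omega>. Z t s \<omega> - \<phi> s \<omega>)) \<longlongrightarrow> 0) (at_right 0)"
      "\<And>t. t \<in> {S..<T} \<Longrightarrow>
      ((\<lambda>\<epsilon>. ennreal (1 / \<epsilon>) * Lpq_norm P 1 1 t (t + \<epsilon>) (\<lambda>s \<omega>. Z t s \<omega> - \<psi> s \<omega>)) \<longlongrightarrow> 0) (at_right 0)"
  shows "process_eq P S T \<phi> \<psi>"
proof -
  interpret P: prob_space P by fact
  interpret L: finite_measure "leb_on S T" by (rule finite_measure_leb_on)
  interpret pair_sigma_finite "leb_on S T" P ..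
  note m [measurable]
  define g where "g = (\<lambda>s. \<integral>\<^sup>+\<omega>. ennreal (norm (\<phi> s \<omega> - \<psi> s \<omega>)) \<partial>P)"
  have g [measurable]: "g \<in> borel_measurable (leb_on S T)"
    unfolding g_def by measurable
  have "(\<integral>\<^sup>+s. g s \<partial>leb_on S T) = 0"
  proof (rule nn_integral_eq_0_if_right_derivative_0[OF g ST])
    fix t assume t: "t \<in> {S..<T}"
    then have [measurable]: "case_prod (Z t) \<in> borel_measurable (leb_on S T \<Otimes>\<^sub>M P)" by (intro mZ) auto
    show "((\<lambda>\<epsilon>. ennreal (1 / \<epsilon>) * (\<integral>\<^sup>+s. indicator {t..t + \<epsilon>} s * g s \<partial>leb_on S T)) \<longlongrightarrow> 0) (at_right 0)"
    proof (rule tendsto_sandwich[OF _ _ tendsto_const])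
      show "((\<lambda>\<epsilon>. ennreal (1 / \<epsilon>) * Lpq_norm P 1 1 t (t + \<epsilon>) (\<lambda>s \<omega>. Z t s \<omega> - \<phi> s \<omega>)
          + ennreal (1 / \<epsilon>) * Lpq_norm P 1 1 t (t + \<epsilon>) (\<lambda>s \<omega>. Z t s \<omega> - \<psi> s \<omega>)) \<longlongrightarrow> 0) (at_right 0)"
        using tendsto_add[OF lim[OF t]] by simp
      have "\<forall>\<^sub>F \<epsilon> in at_right 0. \<epsilon> \<in> {0<..<T - t}"
        using t by (intro eventually_at_rightI[of 0 "T - t"]) auto
      then show "\<forall>\<^sub>F \<epsilon> in at_right 0. ennreal (1 / \<epsilon>) * (\<integral>\<^sup>+s. indicator {t..t + \<epsilon>} s * g s \<partial>leb_on S T)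
          \<le> ennreal (1 / \<epsilon>) * Lpq_norm P 1 1 t (t + \<epsilon>) (\<lambda>s \<omega>. Z t s \<omega> - \<phi> s \<omega>)
          + ennreal (1 / \<epsilon>) * Lpq_norm P 1 1 t (t + \<epsilon>) (\<lambda>s \<omega>. Z t s \<omega> - \<psi> s \<omega>)"
      proof eventually_elim
        case (elim \<epsilon>)
        let ?J = "{t..t + \<epsilon>}"
        have sub: "?J \<subseteq> {S..T}" using elim t by auto
        have [measurable]: "?J \<in> sets (leb_on S T)"
          using Icc_in_sets_leb_on[of t "t + \<epsilon>" S T] by (simp only: Int_absorb2[OF sub])
        have N: "Lpq_norm P 1 1 t (t + \<epsilon>) \<xi> = mixed_Lp (leb_on S T) P 1 1 (\<lambda>s \<omega>. indicator ?J s * ennreal (norm (\<xi> s \<omega>)))"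
          for \<xi> :: "real \<Rightarrow> 'w \<Rightarrow> 'h"
          by (simp add: Lpq_norm_eq_mixed_Lp mixed_Lp_subinterval[OF _ _ sub])
        have "(\<integral>\<^sup>+s. indicator ?J s * g s \<partial>leb_on S T)
            = (\<integral>\<^sup>+s. (\<integral>\<^sup>+\<omega>. indicator ?J s * ennreal (norm (\<phi> s \<omega> - \<psi> s \<omega>)) \<partial>P) \<partial>leb_on S T)"
          unfolding g_def by (intro nn_integral_cong nn_integral_cmult[symmetric]) measurable
        also have "\<dots> = (\<integral>\<^sup>+\<omega>. (\<integral>\<^sup>+s. indicator ?J s * ennreal (norm (\<phi> s \<omega> - \<psi> s \<omega>)) \<partial>leb_on S T) \<partial>P)"
          by (intro Fubini'[symmetric]) measurable
        also have "\<dots> = mixed_Lp (leb_on S T) P 1 1 (\<lambda>s \<omega>. indicator ?J s * ennreal (norm (\<phi> s \<omega> - \<psi> s \<omega>)))"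
          by (simp add: mixed_Lp_def enn_Lp_1)
        also have "\<dots> \<le> mixed_Lp (leb_on S T) P 1 1 (\<lambda>s \<omega>. indicator ?J s * ennreal (norm (Z t s \<omega> - \<phi> s \<omega>))
            + indicator ?J s * ennreal (norm (Z t s \<omega> - \<psi> s \<omega>)))"
        proof (intro mixed_Lp_mono)
          fix s \<omega>
          have "norm (\<phi> s \<omega> - \<psi> s \<omega>) \<le> norm (Z t s \<omega> - \<phi> s \<omega>) + norm (Z t s \<omega> - \<psi> s \<omega>)"
            using norm_triangle_ineq4[of "Z t s \<omega> - \<psi> s \<omega>" "Z t s \<omega> - \<phi> s \<omega>"] by simp
          then have "ennreal (norm (\<phi> s \<omega> - \<psi> s \<omega>)) \<le> ennreal (norm (Z t s \<omega> - \<phi> s \<omega>)) + ennreal (norm (Z t s \<omega> - \<psi> s \<omega>))"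
            by (simp add: ennreal_plus[symmetric] ennreal_leI del: ennreal_plus)
          then show "indicator ?J s * ennreal (norm (\<phi> s \<omega> - \<psi> s \<omega>)) \<le> indicator ?J s * ennreal (norm (Z t s \<omega> - \<phi> s \<omega>))
              + indicator ?J s * ennreal (norm (Z t s \<omega> - \<psi> s \<omega>))"
            by (simp add: indicator_def)
        qed auto
        also have "\<dots> \<le> Lpq_norm P 1 1 t (t + \<epsilon>) (\<lambda>s \<omega>. Z t s \<omega> - \<phi> s \<omega>) + Lpq_norm P 1 1 t (t + \<epsilon>) (\<lambda>s \<omega>. Z t s \<omega> - \<psi> s \<omega>)"
          unfolding N by (intro mixed_Lp_triangle) measurable
        finally show ?case by (simp add: mult_left_mono flip: distrib_left)
      qed
    qed auto
  qed
  also have "(\<integral>\<^sup>+s. g s \<partial>leb_on S T) = (\<integral>\<^sup>+\<omega>. (\<integral>\<^sup>+s. ennreal (norm (\<phi> s \<omega> - \<psi> s \<omega>)) \<partial>leb_on S T) \<partial>P)"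
    unfolding g_def by (intro Fubini'[symmetric]) measurable
  also have "\<dots> = mixed_Lp (leb_on S T) P 1 1 (\<lambda>s \<omega>. ennreal (norm (\<phi> s \<omega> - \<psi> s \<omega>)))"
    by (simp add: mixed_Lp_def enn_Lp_1)
  finally have "AE (s, \<omega>) in leb_on S T \<Otimes>\<^sub>M P. ennreal (norm (\<phi> s \<omega> - \<psi> s \<omega>)) = 0"
    by (subst (asm) mixed_Lp_eq_0_iff) measurable
  then show ?thesis
    unfolding process_eq_def by (auto elim!: eventually_mono)
qed

section \<open>Progressive measurability\<close>

lemma sets_augmented_filtration_subset:
  assumes "\<And>s. 0 \<le> s \<Longrightarrow> W s \<in> borel_measurable P"
  shows "sets (augmented_filtration P W t) \<subseteq> sets P"
proof -
  let ?G = "{W s -` B \<inter> space P | s B. 0 \<le> s \<and> s \<le> t \<and> B \<in> sets borel} \<union> null_sets P"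
  have G: "?G \<subseteq> sets P"
    using assms by (auto intro: measurable_sets)
  then have "?G \<subseteq> Pow (space P)" using sets.space_closed by blast
  then show ?thesis
    unfolding augmented_filtration_def using G by (simp add: sets.sigma_sets_subset)
qed

text \<open>Each progressive set is its own trace at time \<open>T\<close>, hence it belongs to the product \<open>\<sigma>\<close>-field.\<close>

lemma ident_measurable_progressive:
  assumes space: "\<And>t. space (F t) = space P" and sub: "sets (F T) \<subseteq> sets P" and ST: "S \<le> T"
  shows "(\<lambda>z. z) \<in> leb_on S T \<Otimes>\<^sub>M P \<rightarrow>\<^sub>M progressive F S T"
proof (rule measurableI)
  have idF: "(\<lambda>\<omega>. \<omega>) \<in> P \<rightarrow>\<^sub>M F T"
    using sub by (intro measurableI) (auto simp: space intro: sets.Int)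
  have id: "(\<lambda>z. (fst z, snd z)) \<in> leb_on S T \<Otimes>\<^sub>M P \<rightarrow>\<^sub>M restrict_space borel {S..T} \<Otimes>\<^sub>M F T"
    by (intro measurable_Pair measurable_compose[OF measurable_snd idF]
        measurable_compose[OF measurable_fst]) (rule measurable_ident_sets[OF sets_leb_on_eq_borel])
  fix A assume "A \<in> sets (progressive F S T)"
  then have A: "A \<subseteq> {S..T} \<times> space P" "A \<inter> ({S..T} \<times> space P) \<in> sets (restrict_space borel {S..T} \<Otimes>\<^sub>M F T)"
    using ST unfolding sets_progressive[of F, OF space] by auto
  then have "A \<in> sets (restrict_space borel {S..T} \<Otimes>\<^sub>M F T)" by (simp add: Int_absorb2)
  from measurable_sets[OF id this] show "(\<lambda>z. z) -` A \<inter> space (leb_on S T \<Otimes>\<^sub>M P) \<in> sets (leb_on S T \<Otimes>\<^sub>M P)"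
    by simp
qed (simp add: space_progressive space_pair_measure space)

lemma measurable_fst_progressive:
  assumes space: "\<And>t. space (F t) = \<Omega>"
  shows "fst \<in> borel_measurable (progressive F S T)"
  unfolding measurable_progressive_iff[of F, OF space]
  by (intro ballI measurable_compose[OF measurable_fst] measurable_restrict_space1) simp

lemma C1_Lpq_imp_C1_process:
  fixes Z DZ :: "real \<Rightarrow> real \<Rightarrow> 'w \<Rightarrow> 'h::euclidean_space"
  assumes P: "prob_space P" and p: "1 \<le> p" and q: "1 \<le> q" and ST: "S < T"
    and space: "\<And>t. space (F t) = space P" and sub: "sets (F T) \<subseteq> sets P"
    and C1: "C1_Lpq P F p q S T Z DZ"
  shows "C1_process P p q S T Z DZ"
proof -
  interpret P: prob_space P by fact
  note id = ident_measurable_progressive[of F, OF space sub less_imp_le[OF ST]]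
  have Z: "Z \<in> C_Lpq P F p q S T" and DZ: "DZ \<in> C_Lpq P F p q S T"
    using C1 unfolding C1_Lpq_def by blast+
  have "(\<lambda>x. (fst x, snd x)) \<in> leb_on S T \<Otimes>\<^sub>M (leb_on S T \<Otimes>\<^sub>M P)
      \<rightarrow>\<^sub>M restrict_space borel {S..T} \<Otimes>\<^sub>M progressive F S T"
    by (intro measurable_Pair measurable_compose[OF measurable_snd id]
        measurable_compose[OF measurable_fst measurable_ident_sets[OF sets_leb_on_eq_borel]])
  from measurable_compose[OF this, of "\<lambda>(\<tau>, s, \<omega>). DZ \<tau> s \<omega>" borel] C_Lpq_measurable[OF DZ]
  have mDZ: "(\<lambda>(\<tau>, s, \<omega>). DZ \<tau> s \<omega>) \<in> borel_measurable (leb_on S T \<Otimes>\<^sub>M (leb_on S T \<Otimes>\<^sub>M P))"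
    by simp
  have mZ: "case_prod (Z t) \<in> borel_measurable (leb_on S T \<Otimes>\<^sub>M P)" if "t \<in> {S..T}" for t
    by (rule measurable_compose[OF id Lpq_measurable[OF C_Lpq_in_Lpq[OF Z that]]])
  show ?thesis
  proof (intro C1_process.intro C1_process_axioms.intro P p q ST mZ mDZ)
    fix t assume t: "t \<in> {S..T}"
    show "Lpq_norm P p q S T (Z t) < \<top>" by (rule Lpq_finite[OF C_Lpq_in_Lpq[OF Z t]])
    show "Lpq_norm P p q S T (DZ t) < \<top>" by (rule Lpq_finite[OF C_Lpq_in_Lpq[OF DZ t]])
    show "((\<lambda>r. Lpq_norm P p q S T (\<lambda>s \<omega>. DZ r s \<omega> - DZ t s \<omega>)) \<longlongrightarrow> 0) (at t within {S..T})"
      by (rule C_Lpq_tendsto[OF DZ t])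
    show "((\<lambda>r. Lpq_norm P p q S T (\<lambda>s \<omega>. (Z r s \<omega> - Z t s \<omega>) /\<^sub>R (r - t) - DZ t s \<omega>)) \<longlongrightarrow> 0)
        (at t within {S..T})"
      using C1 t unfolding C1_Lpq_def by blast
  qed
qed

theorem lemma2p7:
  fixes P :: "'w measure"
    and W :: "real \<Rightarrow> 'w \<Rightarrow> real ^ 'd"
    and F :: "real \<Rightarrow> 'w measure"
    and Z DZ :: "real \<Rightarrow> real \<Rightarrow> 'w \<Rightarrow> 'h::euclidean_space"
    and p q S T :: real
  assumes "prob_space P" and "complete_measure P" and "brownian_motion P W"
    and "F = augmented_filtration P W"
    and "p \<ge> 1" and "q \<ge> 1" and "0 \<le> S" and "S < T"
    and "C1_Lpq P F p q S T Z DZ"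
  shows "(Diag S T Z DZ \<in> Lpq P F p q S T \<and>
          Lpq_norm P p q S T (Diag S T Z DZ)
            \<le> Lpq_norm P p q S T (Z S) + ennreal (T - S) * (SUP t\<in>{S..T}. Lpq_norm P p q S T (DZ t)))
       \<and> (\<forall>p' q' t. 1 \<le> p' \<and> p' \<le> p \<and> 1 \<le> q' \<and> q' \<le> q \<and> t \<in> {S..<T} \<longrightarrow>
            (\<forall>\<epsilon>\<in>{0<..T - t}. Lpq_norm P p' q' t (t + \<epsilon>) (\<lambda>s \<omega>. Z t s \<omega> - Diag S T Z DZ s \<omega>) < \<infinity>) \<and>
            (\<lambda>\<epsilon>. enn2real (Lpq_norm P p' q' t (t + \<epsilon>) (\<lambda>s \<omega>. Z t s \<omega> - Diag S T Z DZ s \<omega>)))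
              \<in> o[at_right 0](\<lambda>\<epsilon>. \<epsilon> powr (1 + 1 / q' - 1 / q)))
       \<and> (property_D P F S T Z (Diag S T Z DZ) \<and>
          (\<forall>\<phi>. property_D P F S T Z \<phi> \<longrightarrow> process_eq P S T \<phi> (Diag S T Z DZ)))"
proof -
  have space: "space (F t) = space P" for t
    by (simp add: assms(4))
  have "W s \<in> borel_measurable P" if "0 \<le> s" for s
    using assms(3) that by (simp add: brownian_motion_def)
  then have sub: "sets (F T) \<subseteq> sets P"
    unfolding assms(4) by (rule sets_augmented_filtration_subset)
  interpret C1_process P p q S T Z DZ
    by (rule C1_Lpq_imp_C1_process[OF assms(1,5,6,8) space sub assms(9)])
  have Z: "Z \<in> C_Lpq P F p q S T" and DZ: "DZ \<in> C_Lpq P F p q S T"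
    using assms(9) unfolding C1_Lpq_def by blast+
  have "case_prod DiagZ \<in> borel_measurable (progressive F S T)"
  proof (rule measurable_Diag_generic)
    have "sets (leb_on S T \<Otimes>\<^sub>M progressive F S T) = sets (restrict_space borel {S..T} \<Otimes>\<^sub>M progressive F S T)"
      by (intro sets_pair_measure_cong sets_leb_on_eq_borel refl)
    then show "(\<lambda>(\<tau>, s, \<omega>). DZ \<tau> s \<omega>) \<in> borel_measurable (leb_on S T \<Otimes>\<^sub>M progressive F S T)"
      using C_Lpq_measurable[OF DZ] by (simp cong: measurable_cong_sets)
    show "case_prod (Z S) \<in> borel_measurable (progressive F S T)"
      using ST by (intro Lpq_measurable[OF C_Lpq_in_Lpq[OF Z]]) simp
    show "fst \<in> borel_measurable (progressive F S T)"
      by (rule measurable_fst_progressive[of F, OF space])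
  qed (auto simp: space_progressive)
  then have Diag: "DiagZ \<in> Lpq P F p q S T"
    using nrm_Diag_finite unfolding Lpq_def by simp
  have D: "property_D P F S T Z DiagZ"
    unfolding property_D_def
  proof (intro conjI ballI)
    show "Z \<in> C_Lpq P F 1 1 S T"
      by (rule C_Lpq_exponent_mono[OF prob_space_axioms ST measurable_Z _ p _ q Z]) auto
    show "DiagZ \<in> Lpq P F 1 1 S T"
      by (rule Lpq_exponent_mono[OF prob_space_axioms ST measurable_Diag _ p _ q Diag]) auto
  qed (use average_Z_minus_Diag_tendsto_0 in \<open>simp add: Lpq_norm_1_1\<close>)
  have unique: "process_eq P S T \<phi> DiagZ" if \<phi>: "property_D P F S T Z \<phi>" for \<phi>
  proof (rule average_difference_determines_process[OF prob_space_axioms ST _ measurable_Diag measurable_Z])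
    have "case_prod \<phi> \<in> borel_measurable (progressive F S T)"
      using \<phi> Lpq_measurable unfolding property_D_def by blast
    then show "case_prod \<phi> \<in> borel_measurable (L \<Otimes>\<^sub>M P)"
      by (rule measurable_compose[OF ident_measurable_progressive[of F, OF space sub less_imp_le[OF ST]]])
    show "((\<lambda>\<epsilon>. ennreal (1 / \<epsilon>) * Lpq_norm P 1 1 t (t + \<epsilon>) (\<lambda>s \<omega>. Z t s \<omega> - \<phi> s \<omega>)) \<longlongrightarrow> 0) (at_right 0)"
      if "t \<in> {S..<T}" for t
      using \<phi> that unfolding property_D_def Lpq_norm_1_1 by blast
  qed (auto intro: average_Z_minus_Diag_tendsto_0)
  show ?thesis
    unfolding infinity_ennreal_def
    by (intro conjI allI impI ballI Diag nrm_Diag_le D unique Lpq_norm_Z_minus_Diag_finite Z_minus_Diag_smallo)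
      (elim conjE; assumption)+
qed

end
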